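(* If $T=(G,C,L)$ is a critical canvas, then either (1) $C$ has a chord in $G$, or (2) there exists a vertex $v\in V(G)\setminus V(C)$ with at least three neighbors on $C$ such that at most one of the faces of $G[\{v\}\cup V(C)]$ includes a vertex or edge of $G$.
   Context: Graphs are finite and simple. An $L$-coloring of a graph $J$ is a proper coloring $\phi$ with $\phi(v)\in L(v)$ for all $v\in V(J)$; it extends to a supergraph if some $L$-coloring of the supergraph agrees with it. A canvas is a triple $(G,C,L)$ where $G$ is a $2$-connected plane graph, $C$ is its outer cycle, $L$ is a list assignment for some graph containing $G$, $|L(v)|\ge5$ for all $v\in V(G)\setminus V(C)$, and there exists an $L$-coloring of $C$. The canvas is critical if $G\ne C$ and for every proper subgraph $G'\subset G$ with $C\subseteq G'$ some $L$-coloring of $C$ extends to $G'$ but not to $G$. A chord of $C$ is an edge of $G$ not in $C$ with both ends in $V(C)$. A face of $G[\{v\}\cup V(C)]$ includes a vertex or edge of $G$ if that vertex or (interior of the) edge lies in the face. *)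

theory Defs
  imports "HOL-Analysis.Analysis"
begin

section \<open>Finite simple graphs\<close>

record 'a graph =
  verts :: "'a set"
  edges :: "'a set set"

definition simple_graph :: "'a graph \<Rightarrow> bool" where
  "simple_graph G \<longleftrightarrow> finite (verts G) \<and> (\<forall>e\<in>edges G. e \<subseteq> verts G \<and> card e = 2)"

definition subgraph :: "'a graph \<Rightarrow> 'a graph \<Rightarrow> bool" where
  "subgraph H G \<longleftrightarrow> simple_graph H \<and> verts H \<subseteq> verts G \<and> edges H \<subseteq> edges G"

definition proper_subgraph :: "'a graph \<Rightarrow> 'a graph \<Rightarrow> bool" where
  "proper_subgraph H G \<longleftrightarrow> subgraph H G \<and> H \<noteq> G"

definition induced_subgraph :: "'a graph \<Rightarrow> 'a set \<Rightarrow> 'a graph" where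
  "induced_subgraph G X = \<lparr>verts = verts G \<inter> X, edges = {e \<in> edges G. e \<subseteq> X}\<rparr>"

definition connected_graph :: "'a graph \<Rightarrow> bool" where
  "connected_graph G \<longleftrightarrow>
     (\<forall>u\<in>verts G. \<forall>v\<in>verts G. (u, v) \<in> {(x, y). {x, y} \<in> edges G}\<^sup>*)"

definition two_connected :: "'a graph \<Rightarrow> bool" where
  "two_connected G \<longleftrightarrow> card (verts G) > 2 \<and> connected_graph G \<and>
     (\<forall>x\<in>verts G. connected_graph (induced_subgraph G (verts G - {x})))"

definition cycle_graph :: "'a graph \<Rightarrow> bool" where
  "cycle_graph C \<longleftrightarrow>
     (\<exists>xs. distinct xs \<and> length xs \<ge> 3 \<and> verts C = set xs \<and>
           edges C = {{xs ! i, xs ! (Suc i mod length xs)} | i. i < length xs})"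

definition chord :: "'a graph \<Rightarrow> 'a graph \<Rightarrow> 'a set \<Rightarrow> bool" where
  "chord G C e \<longleftrightarrow> e \<in> edges G \<and> e \<notin> edges C \<and> e \<subseteq> verts C"

definition neighbors :: "'a graph \<Rightarrow> 'a \<Rightarrow> 'a set" where
  "neighbors G v = {u \<in> verts G. {v, u} \<in> edges G}"


section \<open>Plane graphs\<close>

text \<open>
  The vertices of a plane graph are points of the plane, and \<open>D e\<close> is the arc representing
  the edge \<open>e\<close>. Subgraphs are drawn by the same map \<open>D\<close>. The set
  \<open>e\<close> consists of the two ends of \<open>D e\<close>, so \<open>D e - e\<close> is the interior of the edge.
\<close>

type_synonym drawing = "complex set \<Rightarrow> complex set"

definition edge_interior :: "drawing \<Rightarrow> complex set \<Rightarrow> complex set" where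
  "edge_interior D e = D e - e"

definition plane_graph :: "complex graph \<Rightarrow> drawing \<Rightarrow> bool" where
  "plane_graph G D \<longleftrightarrow> simple_graph G \<and>
     (\<forall>e\<in>edges G. \<exists>g. arc g \<and> path_image g = D e \<and> {pathstart g, pathfinish g} = e) \<and>
     (\<forall>e\<in>edges G. edge_interior D e \<inter> verts G = {}) \<and>
     (\<forall>e\<in>edges G. \<forall>f\<in>edges G. e \<noteq> f \<longrightarrow> edge_interior D e \<inter> D f = {})"

definition point_set :: "complex graph \<Rightarrow> drawing \<Rightarrow> complex set" where
  "point_set G D = verts G \<union> (\<Union>e\<in>edges G. D e)"

definition faces :: "complex graph \<Rightarrow> drawing \<Rightarrow> complex set set" where
  "faces G D = components (- point_set G D)"

definition outer_cycle :: "complex graph \<Rightarrow> drawing \<Rightarrow> complex graph \<Rightarrow> bool" where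
  "outer_cycle G D C \<longleftrightarrow> cycle_graph C \<and> subgraph C G \<and>
     (\<exists>F\<in>faces G D. \<not> bounded F \<and> frontier F = point_set C D)"

definition face_includes_some :: "complex graph \<Rightarrow> drawing \<Rightarrow> complex set \<Rightarrow> bool" where
  "face_includes_some G D F \<longleftrightarrow>
     (\<exists>x\<in>verts G. x \<in> F) \<or> (\<exists>e\<in>edges G. edge_interior D e \<subseteq> F)"


section \<open>List colorings and critical canvases\<close>

text \<open>Colorings are total functions; only their values on the vertices of the graph matter.\<close>

definition list_coloring :: "'a graph \<Rightarrow> ('a \<Rightarrow> 'c set) \<Rightarrow> ('a \<Rightarrow> 'c) \<Rightarrow> bool" where
  "list_coloring J L \<phi> \<longleftrightarrow>
     (\<forall>v\<in>verts J. \<phi> v \<in> L v) \<and> (\<forall>u v. {u, v} \<in> edges J \<longrightarrow> \<phi> u \<noteq> \<phi> v)"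

definition coloring_extends ::
  "'a graph \<Rightarrow> 'a graph \<Rightarrow> ('a \<Rightarrow> 'c set) \<Rightarrow> ('a \<Rightarrow> 'c) \<Rightarrow> bool" where
  "coloring_extends J H L \<phi> \<longleftrightarrow>
     (\<exists>\<psi>. list_coloring H L \<psi> \<and> (\<forall>v\<in>verts J. \<psi> v = \<phi> v))"

text \<open>
  Lists are arbitrary sets of colors. As \<open>card\<close> is 0 on infinite sets, infinite lists are
  admitted separately in the size condition.
\<close>

definition canvas ::
  "complex graph \<Rightarrow> drawing \<Rightarrow> complex graph \<Rightarrow> (complex \<Rightarrow> 'c set) \<Rightarrow> bool" where
  "canvas G D C L \<longleftrightarrow> plane_graph G D \<and> two_connected G \<and> outer_cycle G D C \<and>
     (\<forall>v\<in>verts G - verts C. infinite (L v) \<or> card (L v) \<ge> 5) \<and>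
     (\<exists>\<phi>. list_coloring C L \<phi>)"

definition critical_canvas ::
  "complex graph \<Rightarrow> drawing \<Rightarrow> complex graph \<Rightarrow> (complex \<Rightarrow> 'c set) \<Rightarrow> bool" where
  "critical_canvas G D C L \<longleftrightarrow> canvas G D C L \<and> G \<noteq> C \<and>
     (\<forall>G'. proper_subgraph G' G \<and> subgraph C G' \<longrightarrow>
        (\<exists>\<phi>. list_coloring C L \<phi> \<and> coloring_extends C G' L \<phi> \<and> \<not> coloring_extends C G L \<phi>))"

end

theory Submission
  imports Defs
begin

text \<open>
  Call a vertex outside \<open>C\<close> heavy if it has at least three neighbors on \<open>C\<close>. Among all
  pairs of a heavy vertex \<open>v\<close> and a face \<open>F\<close> of \<open>G[{v} \<union> C]\<close> containing a vertex of \<open>G\<close>,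
  choose one with the fewest vertices in \<open>F\<close>. If \<open>F\<close> contains a heavy vertex \<open>x\<close> for which (2)
  fails, then some face of \<open>G[{x} \<union> C]\<close> that contains a vertex of \<open>G\<close> but not \<open>v\<close> lies properly
  inside \<open>F\<close>, contradicting minimality. So no vertex in \<open>F\<close> is heavy, and every coloring of \<open>G\<close>
  minus the vertices in \<open>F\<close> extends to \<open>G\<close> by Thomassen's theorem: the vertices in \<open>F\<close> next to
  \<open>C\<close> keep three colors, the others five, and only \<open>v\<close> is precolored. This contradicts criticality.

  Thomassen's theorem is proved without triangulating and without contracting edges: a connected
  vertex set \<open>Z\<close> (here \<open>C\<close>) stands for the outer face, and the only consequence of planarity that
  is used is the absence of one configuration (\<open>no_apex_minor\<close>), which follows from
  Janiszewski's theorem.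
\<close>

section \<open>Arcs and Jordan curves\<close>

text \<open>An arc in \<open>P\<close> to a point of \<open>K\<close> is cut at the first parameter
  \<open>s\<close> whose value lies in \<open>K\<close>; it exists because the preimage of
  \<open>K\<close> is compact.\<close>

lemma arc_to_closed_set:
  fixes P K :: "'a::euclidean_space set"
  assumes "path_connected P" "closed K" "x \<in> P" "x \<notin> K" "P \<inter> K \<noteq> {}"
  obtains g where "arc g" "path_image g \<subseteq> P" "pathstart g = x"
    "path_image g \<inter> K = {pathfinish g}"
proof -
  obtain y where y: "y \<in> P" "y \<in> K" using assms by blast
  then have "x \<noteq> y" using assms by blast
  then obtain h where h: "arc h" "path_image h \<subseteq> P" "pathstart h = x" "pathfinish h = y"
    using assms(1) y assms(3) unfolding path_connected_arcwise by blast
  define A where "A = {t \<in> {0..1}. h t \<in> K}"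
  have "continuous_on {0..1} h"
    using h(1) by (simp add: arc_def path_def)
  then have "closed A"
    unfolding A_def using continuous_closed_preimage[of "{0..1}" h K] assms(2)
    by (simp add: vimage_def Int_def)
  moreover have "1 \<in> A"
    using h(4) y by (simp add: A_def pathfinish_def)
  moreover have "bounded A"
    by (rule bounded_subset[of "{0..1}"]) (auto simp: A_def)
  ultimately obtain s where s: "s \<in> A" "\<And>t. t \<in> A \<Longrightarrow> s \<le> t"
    using compact_attains_inf[of A] by (auto simp: compact_eq_bounded_closed)
  have "s \<noteq> 0"
    using h(3) assms(4) s(1) by (auto simp: A_def pathstart_def)
  then have s01: "0 < s" "s \<le> 1" using s(1) by (auto simp: A_def)
  have im: "path_image (subpath 0 s h) = h ` {0..s}"
    using s01 by (simp add: path_image_subpath)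
  show ?thesis
  proof
    show "arc (subpath 0 s h)"
      using h(1) s01 by (intro arc_subpath_arc) auto
    show "path_image (subpath 0 s h) \<subseteq> P"
      using h(2) s01 unfolding im by (auto simp: path_image_def)
    show "pathstart (subpath 0 s h) = x"
      using h(3) unfolding pathstart_subpath by (simp add: pathstart_def)
    show "path_image (subpath 0 s h) \<inter> K = {pathfinish (subpath 0 s h)}"
    proof -
      have "h t \<in> K \<Longrightarrow> t \<in> {0..s} \<Longrightarrow> t = s" for t
        using s(2)[of t] s01 by (auto simp: A_def)
      then have "h ` {0..s} \<inter> K \<subseteq> {h s}" by blast
      moreover have "h s \<in> h ` {0..s} \<inter> K"
        using s(1) s01 by (auto simp: A_def)
      ultimately show ?thesis
        unfolding im pathfinish_subpath by blast
    qed
  qed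
qed

lemma connected_arc_minus_pathfinish:
  fixes g :: "real \<Rightarrow> 'a::t2_space"
  assumes "arc g"
  shows "connected (path_image g - {pathfinish g})"
proof -
  have "path_image g - {pathfinish g} = g ` {0..<1}"
  proof -
    have "inj_on g {0..1}" using assms by (simp add: arc_def)
    then have "g t \<noteq> g 1" if "t \<in> {0..<1}" for t
      using that inj_onD[of g "{0..1}" t 1] by auto
    moreover have "{0..1} = insert 1 {0..<1::real}" by auto
    ultimately show ?thesis
      by (auto simp: path_image_def pathfinish_def)
  qed
  moreover have "continuous_on {0..<1} g"
    using assms by (auto simp: arc_def path_def elim: continuous_on_subset)
  ultimately show ?thesis
    by (metis connected_Ico connected_continuous_image)
qed

lemma connected_arc_minus_pathstart:
  fixes g :: "real \<Rightarrow> 'a::t2_space"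
  assumes "arc g"
  shows "connected (path_image g - {pathstart g})"
  using connected_arc_minus_pathfinish[of "reversepath g"] assms
  by (simp add: arc_reversepath)

text \<open>The crossing arguments use arcs with their ends removed. This recovers the ends as limit
  points, which is the form in which \<open>no_crossing_chords\<close> takes them.\<close>

lemma pathfinish_in_closure_arc_interior:
  fixes g :: "real \<Rightarrow> 'a::real_normed_vector"
  assumes "arc g"
  shows "pathfinish g \<in> closure (path_image g - {pathstart g, pathfinish g})"
proof -
  have cont: "continuous_on {0..1} g" and inj: "inj_on g {0..1}"
    using assms by (auto simp: arc_def path_def)
  have sub: "g ` {0<..<1} \<subseteq> path_image g - {pathstart g, pathfinish g}"
  proof clarify
    fix t :: real assume "t \<in> {0<..<1}"
    then show "g t \<in> path_image g - {pathstart g, pathfinish g}"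
      using inj_onD[OF inj, of t 0] inj_onD[OF inj, of t 1]
      by (auto simp: path_image_def pathstart_def pathfinish_def)
  qed
  have "g ` closure {0<..<1} \<subseteq> closure (g ` {0<..<1})"
    by (rule image_closure_subset) (use cont in \<open>auto intro: closure_subset[THEN subsetD]\<close>)
  then have "g 1 \<in> closure (g ` {0<..<1})" by auto
  then show ?thesis
    using closure_mono[OF sub] by (auto simp: pathfinish_def)
qed

section \<open>The two sides of a closed curve\<close>

lemma Jordan_components:
  fixes c :: "real \<Rightarrow> complex"
  assumes "simple_path c" "pathfinish c = pathstart c"
  obtains I E where "I \<noteq> E" "components (- path_image c) = {I, E}"
    "path_image c \<subseteq> closure I" "path_image c \<subseteq> closure E"
proof -
  obtain I E where IE: "I \<noteq> {}" "open I" "connected I" "E \<noteq> {}" "open E" "connected E"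
      "I \<inter> E = {}" "I \<union> E = - path_image c" "frontier I = path_image c" "frontier E = path_image c"
    using Jordan_curve[OF assms] by metis
  \<comment> \<open>A connected set containing \<open>A\<close> inside \<open>A \<union> B\<close>
    cannot reach the open set \<open>B\<close>, as \<open>A\<close> and \<open>B\<close> would
    disconnect it.\<close>
  have *: "A \<in> components (A \<union> B)" if "open A" "open B" "connected A" "A \<noteq> {}" "A \<inter> B = {}" for A B :: "complex set"
    unfolding in_components_maximal
  proof (intro conjI allI impI)
    fix W assume W: "W \<noteq> {} \<and> A \<subseteq> W \<and> W \<subseteq> A \<union> B \<and> connected W"
    then have "B \<inter> W = {}"
      using connectedD[of W A B] that by blast
    with W show "W = A" by blast
  qed (use that in auto)
  have in_comp: "I \<in> components (- path_image c)" "E \<in> components (- path_image c)"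
    using *[of I E] *[of E I] IE by (simp_all add: Un_commute Int_commute)
  have "W = I \<or> W = E" if "W \<in> components (- path_image c)" for W
  proof -
    have "W \<inter> (I \<union> E) \<noteq> {}"
      using that IE(8) in_components_nonempty in_components_subset by blast
    then show ?thesis
      using components_nonoverlap[OF that] in_comp by blast
  qed
  with in_comp have "components (- path_image c) = {I, E}" by blast
  moreover have "I \<noteq> E" using IE by blast
  moreover have "path_image c \<subseteq> closure I" "path_image c \<subseteq> closure E"
    using IE(9,10) by (auto simp: frontier_def)
  ultimately show ?thesis by (intro that)
qed

text \<open>The curve is kept as a pair of arcs with common ends because
  \<open>no_crossing_chords\<close> must tell which of the two arcs a point lies on.\<close>

lemma theta_components:
  fixes b1 b2 :: "real \<Rightarrow> complex"
  assumes "arc b1" "pathstart b1 = p" "pathfinish b1 = q"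
    and "arc b2" "pathstart b2 = p" "pathfinish b2 = q"
    and "path_image b1 \<inter> path_image b2 = {p, q}"
  obtains I E where "I \<noteq> E" "components (- (path_image b1 \<union> path_image b2)) = {I, E}"
    "path_image b1 \<union> path_image b2 \<subseteq> closure I" "path_image b1 \<union> path_image b2 \<subseteq> closure E"
proof -
  let ?c = "b1 +++ reversepath b2"
  have "simple_path ?c" "pathfinish ?c = pathstart ?c"
    using assms by (auto simp: simple_path_join_loop_eq arc_reversepath)
  moreover have "path_image ?c = path_image b1 \<union> path_image b2"
    using assms by (simp add: path_image_join)
  ultimately show ?thesis
    using Jordan_components that by metis
qed

text \<open>Since the other side \<open>R'\<close> has the whole curve in its closure,
  \<open>\<delta>\<close> is joined to \<open>R'\<close> through \<open>x2\<close> off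
  \<open>b1\<close> and \<open>\<gamma>\<close>, and through \<open>x1\<close> off \<open>b2\<close>
  and \<open>\<gamma>\<close>. By Janiszewski's theorem it is then joined to \<open>R'\<close> off
  both arcs, although it lies in \<open>R\<close>.\<close>

lemma no_crossing_chords:
  fixes b1 b2 :: "real \<Rightarrow> complex"
  assumes "arc b1" "pathstart b1 = p" "pathfinish b1 = q"
    and "arc b2" "pathstart b2 = p" "pathfinish b2 = q"
    and b12: "path_image b1 \<inter> path_image b2 = {p, q}"
    and R: "R \<in> components (- (path_image b1 \<union> path_image b2))"
    and \<gamma>: "compact \<gamma>" "connected \<gamma>" "p \<in> \<gamma>" "q \<in> \<gamma>" "\<gamma> - {p, q} \<subseteq> R"
    and \<delta>: "connected \<delta>" "\<delta> \<subseteq> R - \<gamma>"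
    and x1: "x1 \<in> closure \<delta>" "x1 \<in> path_image b1 - {p, q}"
    and x2: "x2 \<in> closure \<delta>" "x2 \<in> path_image b2 - {p, q}"
  shows False
proof -
  let ?J = "path_image b1 \<union> path_image b2"
  obtain R' where R': "R' \<in> components (- ?J)" "R' \<noteq> R" "?J \<subseteq> closure R'"
    using theta_components[OF assms(1-7)] R by (metis insertCI insertE singletonD)
  have disj: "R \<inter> R' = {}"
    using components_nonoverlap[OF R R'(1)] R'(2) by blast
  have sub: "R \<inter> ?J = {}" "R' \<inter> ?J = {}"
    using in_components_subset[OF R] in_components_subset[OF R'(1)] by blast+
  have con': "connected R'" using R'(1) by (rule in_components_connected)
  obtain y where y: "y \<in> R'" using R'(1) in_components_nonempty by blast
  have "\<delta> \<noteq> {}" using x1(1) by auto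
  then obtain x where x: "x \<in> \<delta>" by blast
  have conn: "connected (insert z (R' \<union> \<delta>))" if "z \<in> closure \<delta>" "z \<in> ?J" for z
  proof -
    have "connected (insert z R')"
      by (rule connected_intermediate_closure[OF con']) (use that R'(3) closure_subset in auto)
    moreover have "connected (insert z \<delta>)"
      by (rule connected_intermediate_closure[OF \<delta>(1)]) (use that closure_subset in auto)
    ultimately have "connected (insert z R' \<union> insert z \<delta>)"
      by (rule connected_Un) auto
    moreover have "insert z R' \<union> insert z \<delta> = insert z (R' \<union> \<delta>)" by blast
    ultimately show ?thesis by simp
  qed
  have c1: "connected_component (- (path_image b1 \<union> \<gamma>)) x y"
    unfolding connected_component_def
    by (rule exI[of _ "insert x2 (R' \<union> \<delta>)"], intro conjI conn)
      (use x2 x y \<gamma> \<delta> sub disj b12 in blast)+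
  have c2: "connected_component (- (path_image b2 \<union> \<gamma>)) x y"
    unfolding connected_component_def
    by (rule exI[of _ "insert x1 (R' \<union> \<delta>)"], intro conjI conn)
      (use x1 x y \<gamma> \<delta> sub disj b12 in blast)+
  \<comment> \<open>Janiszewski's theorem requires the two obstacles to meet in a connected set; as
    \<open>p\<close> and \<open>q\<close> lie on \<open>\<gamma>\<close>, it is
    \<open>\<gamma>\<close> itself.\<close>
  have "(path_image b1 \<union> \<gamma>) \<inter> (path_image b2 \<union> \<gamma>) = \<gamma>"
    unfolding Un_Int_distrib2[symmetric] b12 using \<gamma>(3,4) by blast
  then have "connected_component (- ((path_image b1 \<union> \<gamma>) \<union> (path_image b2 \<union> \<gamma>))) x y"
    using assms(1,4) \<gamma>(1,2)
    by (intro Janiszewski c1 c2 compact_Un compact_imp_closed compact_arc_image) simp_all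
  then have "connected_component (- ?J) x y"
    by (rule connected_component_of_subset) auto
  then obtain T where T: "connected T" "T \<subseteq> - ?J" "x \<in> T" "y \<in> T"
    unfolding connected_component_def by blast
  then have "T \<subseteq> R"
    using x \<delta>(2) by (intro components_maximal[OF R]) auto
  with T(4) have "y \<in> R" by blast
  with y disj show False by blast
qed

lemma arc_split:
  fixes g :: "real \<Rightarrow> 'a::real_normed_vector"
  assumes "arc g" "t \<in> path_image g" "t \<noteq> pathstart g" "t \<noteq> pathfinish g"
  obtains h k where "arc h" "pathstart h = pathstart g" "pathfinish h = t"
    "arc k" "pathstart k = t" "pathfinish k = pathfinish g"
    "path_image h \<union> path_image k = path_image g" "path_image h \<inter> path_image k = {t}"
proof -
  obtain s where s: "s \<in> {0..1}" "t = g s"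
    using assms(2) by (auto simp: path_image_def)
  then have s01: "0 < s" "s < 1"
    using assms(3,4) by (auto simp: pathstart_def pathfinish_def less_le)
  have inj: "inj_on g {0..1}" using assms(1) by (simp add: arc_def)
  have im: "path_image (subpath 0 s g) = g ` {0..s}" "path_image (subpath s 1 g) = g ` {s..1}"
    using s01 by (simp_all add: path_image_subpath)
  have "{0..s} \<union> {s..1} = {0..1}" "{0..s} \<inter> {s..1} = {s}" using s01 by auto
  then have "g ` {0..s} \<union> g ` {s..1} = g ` {0..1}" "g ` {0..s} \<inter> g ` {s..1} = {t}"
    using inj_on_image_Int[OF inj, of "{0..s}" "{s..1}"] s s01 by (auto simp flip: image_Un)
  then show ?thesis
    using that[of "subpath 0 s g" "subpath s 1 g"] assms(1) s s01 im
    by (simp add: arc_subpath_arc pathstart_def[of g] pathfinish_def[of g] path_image_def[of g])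
qed

section \<open>Components of complements\<close>

lemma component_containing:
  fixes S :: "'a::topological_space set"
  assumes "connected A" "A \<noteq> {}" "A \<subseteq> S"
  obtains R where "R \<in> components S" "A \<subseteq> R"
  using exists_component_superset[OF assms(3) _ assms(1)] assms(2,3) by (metis subset_empty)

text \<open>A connected set that contains \<open>F\<close> and more must meet the frontier of
  \<open>F\<close>, so the component around \<open>F\<close> is no larger. This identifies faces of
  one drawing as faces of a smaller one.\<close>

lemma component_if_frontier_subset:
  fixes F :: "'a::euclidean_space set"
  assumes "connected F" "F \<noteq> {}" "F \<inter> S = {}" "frontier F \<subseteq> S"
  shows "F \<in> components (- S)"
proof -
  obtain R where R: "R \<in> components (- S)" "F \<subseteq> R"
    using component_containing[of F "- S"] assms by blast
  have "R \<inter> frontier F = {}"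
    using in_components_subset[OF R(1)] assms(4) by blast
  then have "R - F = {}"
    using connected_Int_frontier[OF in_components_connected[OF R(1)], of F] R(2) assms(2) by blast
  with R show ?thesis by auto
qed

section \<open>A list coloring theorem of Thomassen\<close>

text \<open>Being reflexive, this relates even a vertex outside \<open>X\<close> to itself; hence
  the premise \<open>x \<in> X\<close> where such walks are turned into arcs.\<close>

definition linked :: "('a \<Rightarrow> 'a \<Rightarrow> bool) \<Rightarrow> 'a set \<Rightarrow> 'a \<Rightarrow> 'a \<Rightarrow> bool" where
  "linked E X = (\<lambda>x y. x \<in> X \<and> y \<in> X \<and> E x y)\<^sup>*\<^sup>*"

lemma linked_mono: "linked E X x y \<Longrightarrow> X \<subseteq> Y \<Longrightarrow> linked E Y x y"
  unfolding linked_def by (erule rtranclp_mono[THEN predicate2D, rotated]) blast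

lemma linked_edge: "E x y \<Longrightarrow> x \<in> X \<Longrightarrow> y \<in> X \<Longrightarrow> linked E X x y"
  unfolding linked_def by blast

lemma linked_trans: "linked E X x y \<Longrightarrow> linked E X y z \<Longrightarrow> linked E X x z"
  unfolding linked_def by (rule rtranclp_trans)

lemma linked_refl [simp]: "linked E X x x"
  unfolding linked_def by simp

definition attached :: "('a \<Rightarrow> 'a \<Rightarrow> bool) \<Rightarrow> 'a set \<Rightarrow> 'a set" where
  "attached E Z = {u. \<exists>z\<in>Z. E z u}"

lemma attached_insert: "u \<in> attached E (insert z Z) \<longleftrightarrow> E z u \<or> u \<in> attached E Z"
  by (auto simp: attached_def)

text \<open>Lists bind only outside \<open>P\<close>: precolored vertices take the values of
  \<open>c\<close>, whatever their lists are.\<close>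

definition list_colorable ::
  "('a \<Rightarrow> 'a \<Rightarrow> bool) \<Rightarrow> 'a set \<Rightarrow> ('a \<Rightarrow> 'c set) \<Rightarrow> 'a set \<Rightarrow> ('a \<Rightarrow> 'c) \<Rightarrow> bool" where
  "list_colorable E U L P c \<longleftrightarrow>
     (\<exists>\<psi>. (\<forall>x\<in>U. \<forall>y\<in>U. E x y \<longrightarrow> \<psi> x \<noteq> \<psi> y) \<and> (\<forall>u\<in>P. \<psi> u = c u) \<and> (\<forall>u\<in>U - P. \<psi> u \<in> L u))"

text \<open>The connected set \<open>Z\<close> plays the role of a single vertex placed in the outer face, so that
  \<open>U \<inter> attached E Z\<close> is the outer boundary of the graph on \<open>U\<close>; \<open>P\<close> is
  the precolored clique. Deleting a boundary vertex amounts to moving it from \<open>U\<close> to \<open>Z\<close>.\<close>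

locale apex_planar =
  fixes V :: "'a set" and E :: "'a \<Rightarrow> 'a \<Rightarrow> bool"
  assumes sym: "E x y \<Longrightarrow> E y x" and irrefl: "\<not> E x x"
    \<comment> \<open>With \<open>Z\<close> contracted to a vertex, this obstructs planarity: in
      \<open>U\<close> without \<open>v\<close>, the vertices \<open>w1\<close>, \<open>w2\<close>,
      \<open>w3\<close> either root a triangle minor or have disjoint paths to a common vertex.
      Together with \<open>v\<close> and \<open>Z\<close> this gives a K5 or a K(3,3) minor.\<close>
    and no_apex_minor: "\<lbrakk>Z \<subseteq> V; U \<subseteq> V; Z \<inter> U = {}; \<And>x y. x \<in> Z \<Longrightarrow> y \<in> Z \<Longrightarrow> linked E Z x y;
      {v, w1, w2, w3} \<subseteq> U \<inter> attached E Z; distinct [v, w1, w2, w3]; E v w1; E v w2; E v w3;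
      linked E (U - {v, w3}) w1 w2; linked E (U - {v, w1}) w3 w2; linked E (U - {v, w2}) w3 w1\<rbrakk>
      \<Longrightarrow> False"
begin

text \<open>Thomassen's hypotheses: five colors inside, three on the boundary, and a precolored
  vertex or edge there. \<open>P\<close> and \<open>Z\<close> may be empty, which covers graphs
  without any boundary. Since \<open>card\<close> is 0 on infinite sets, the lists outside
  \<open>P\<close> are finite.\<close>

definition thomassen_instance ::
  "'a set \<Rightarrow> 'a set \<Rightarrow> ('a \<Rightarrow> 'c set) \<Rightarrow> 'a set \<Rightarrow> ('a \<Rightarrow> 'c) \<Rightarrow> bool" where
  "thomassen_instance Z U L P c \<longleftrightarrow> finite U \<and> U \<subseteq> V \<and> Z \<subseteq> V \<and> Z \<inter> U = {} \<and>
     (\<forall>x\<in>Z. \<forall>y\<in>Z. linked E Z x y) \<and>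
     P \<subseteq> U \<inter> attached E Z \<and> card P \<le> 2 \<and> (\<forall>p\<in>P. \<forall>q\<in>P. p \<noteq> q \<longrightarrow> E p q \<and> c p \<noteq> c q) \<and>
     (\<forall>u\<in>U - P. card (L u) \<ge> (if u \<in> attached E Z then 3 else 5))"

section \<open>Restricting instances and gluing along separating edges\<close>

lemma thomassen_instance_list:
  "thomassen_instance Z U L P c \<Longrightarrow> u \<in> U - P \<Longrightarrow> (if u \<in> attached E Z then 3 else 5) \<le> card (L u)"
  unfolding thomassen_instance_def by blast

lemma thomassen_instance_subset:
  assumes "thomassen_instance Z U L P c" "U' \<subseteq> U" "P \<subseteq> U'"
  shows "thomassen_instance Z U' L P c"
proof -
  have "\<forall>u\<in>U' - P. (if u \<in> attached E Z then 3 else 5) \<le> card (L u)"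
    using thomassen_instance_list[OF assms(1)] assms(2) by blast
  moreover have "Z \<inter> U' = {}" "finite U'" "U' \<subseteq> V"
    using assms(1,2) by (auto simp: thomassen_instance_def finite_subset)
  ultimately show ?thesis
    using assms(1,3) unfolding thomassen_instance_def by simp
qed

lemma linked_insert:
  assumes "\<forall>x\<in>Z. \<forall>y\<in>Z. linked E Z x y" "v \<in> attached E Z \<or> Z = {}"
  shows "\<forall>x\<in>insert v Z. \<forall>y\<in>insert v Z. linked E (insert v Z) x y"
proof -
  have ZZ: "linked E (insert v Z) x y" if "x \<in> Z" "y \<in> Z" for x y
    using assms(1) that by (meson linked_mono subset_insertI)
  have "linked E (insert v Z) v x \<and> linked E (insert v Z) x v" if x: "x \<in> Z" for x
  proof -
    obtain z where "z \<in> Z" "E z v" using assms(2) x by (auto simp: attached_def)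
    then have "linked E (insert v Z) z v" "linked E (insert v Z) v z"
      using sym by (auto intro: linked_edge)
    then show ?thesis using ZZ[OF x \<open>z \<in> Z\<close>] ZZ[OF \<open>z \<in> Z\<close> x] linked_trans by metis
  qed
  with ZZ show ?thesis by auto
qed

text \<open>The side containing \<open>P\<close> is colored first; the colors this gives to
  \<open>v\<close> and \<open>w\<close> then precolor the edge \<open>vw\<close> on the other side.
  As \<open>A\<close> and \<open>B\<close> are nonempty, both sides are smaller than
  \<open>U\<close>.\<close>

lemma glue_along_chord:
  fixes L :: "'a \<Rightarrow> 'c set"
  assumes inst: "thomassen_instance Z U L P c"
    and IH: "\<forall>Z' U' (L' :: 'a \<Rightarrow> 'c set) P' c'. card U' < card U \<longrightarrow>
        thomassen_instance Z' U' L' P' c' \<longrightarrow> list_colorable E U' L' P' c'"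
    and vw: "v \<in> attached E Z" "w \<in> attached E Z" "E v w"
    and U: "U = A \<union> B \<union> {v, w}" "A \<inter> B = {}" "v \<notin> A \<union> B" "w \<notin> A \<union> B" "A \<noteq> {}" "B \<noteq> {}"
    and AB: "\<And>x y. x \<in> A \<Longrightarrow> y \<in> B \<Longrightarrow> \<not> E x y"
    and P: "P \<subseteq> A \<union> {v, w}"
  shows "list_colorable E U L P c"
proof -
  have fin: "finite U" using inst by (simp add: thomassen_instance_def)
  have "v \<noteq> w" using vw irrefl by auto
  have "A \<union> {v, w} \<subset> U" "B \<union> {v, w} \<subset> U" using U by blast+
  then have less: "card (A \<union> {v, w}) < card U" "card (B \<union> {v, w}) < card U"
    using fin by (auto intro: psubset_card_mono)
  have "thomassen_instance Z (A \<union> {v, w}) L P c"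
    using inst P U(1) by (intro thomassen_instance_subset[OF inst]) auto
  from IH[rule_format, OF less(1) this] obtain \<psi> where \<psi>:
    "\<forall>x\<in>A \<union> {v, w}. \<forall>y\<in>A \<union> {v, w}. E x y \<longrightarrow> \<psi> x \<noteq> \<psi> y" "\<forall>u\<in>P. \<psi> u = c u"
    "\<forall>u\<in>A \<union> {v, w} - P. \<psi> u \<in> L u"
    unfolding list_colorable_def by blast
  have "thomassen_instance Z (B \<union> {v, w}) L {v, w} \<psi>"
    unfolding thomassen_instance_def
  proof (intro conjI)
    show "\<forall>p\<in>{v, w}. \<forall>q\<in>{v, w}. p \<noteq> q \<longrightarrow> E p q \<and> \<psi> p \<noteq> \<psi> q"
      using \<psi>(1) vw sym[OF vw(3)] by auto
    show "\<forall>u\<in>B \<union> {v, w} - {v, w}. card (L u) \<ge> (if u \<in> attached E Z then 3 else 5)"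
    proof
      fix u assume "u \<in> B \<union> {v, w} - {v, w}"
      then have "u \<in> U - P" using P U by blast
      then show "card (L u) \<ge> (if u \<in> attached E Z then 3 else 5)"
        by (rule thomassen_instance_list[OF inst])
    qed
    show "card {v, w} \<le> 2" by (simp add: card_insert_if)
  qed (use inst U vw in \<open>auto simp: thomassen_instance_def\<close>)
  from IH[rule_format, OF less(2) this] obtain \<theta> where \<theta>:
    "\<forall>x\<in>B \<union> {v, w}. \<forall>y\<in>B \<union> {v, w}. E x y \<longrightarrow> \<theta> x \<noteq> \<theta> y" "\<forall>u\<in>{v, w}. \<theta> u = \<psi> u"
    "\<forall>u\<in>B \<union> {v, w} - {v, w}. \<theta> u \<in> L u"
    unfolding list_colorable_def by blast
  let ?f = "\<lambda>u. if u \<in> B then \<theta> u else \<psi> u"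
  have "?f x \<noteq> ?f y" if "x \<in> U" "y \<in> U" "E x y" for x y
  proof (cases "x \<in> B \<union> {v, w} \<and> y \<in> B \<union> {v, w}")
    case True
    then show ?thesis using \<theta>(1,2) that(3) U(3,4) by (metis (full_types) Un_iff insert_iff singletonD)
  next
    case False
    moreover have "\<not> (x \<in> A \<and> y \<in> B)" "\<not> (x \<in> B \<and> y \<in> A)"
      using AB that(3) sym by blast+
    ultimately have "x \<in> A \<union> {v, w}" "y \<in> A \<union> {v, w}" "x \<notin> B" "y \<notin> B"
      using that U by blast+
    then show ?thesis using \<psi>(1) that(3) by auto
  qed
  moreover have "?f u = c u" if "u \<in> P" for u
    using \<psi>(2) that P U(2-4) by auto
  moreover have "?f u \<in> L u" if "u \<in> U - P" for u
    using \<psi>(3) \<theta>(3) that U by auto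
  ultimately show ?thesis unfolding list_colorable_def by (intro exI[of _ ?f]) blast
qed

text \<open>The ends of a boundary edge separate \<open>U\<close>; \<open>A\<close> is the part
  reachable from \<open>a\<close> and \<open>B\<close> the rest. The clique \<open>P\<close> cannot
  meet both, so one of the two orders of gluing applies.\<close>

lemma color_by_chord:
  fixes L :: "'a \<Rightarrow> 'c set"
  assumes inst: "thomassen_instance Z U L P c"
    and IH: "\<forall>Z' U' (L' :: 'a \<Rightarrow> 'c set) P' c'. card U' < card U \<longrightarrow>
        thomassen_instance Z' U' L' P' c' \<longrightarrow> list_colorable E U' L' P' c'"
    and vw: "v \<in> U \<inter> attached E Z" "w \<in> U \<inter> attached E Z" "E v w"
    and ab: "a \<in> U - {v, w}" "b \<in> U - {v, w}" "\<not> linked E (U - {v, w}) a b"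
  shows "list_colorable E U L P c"
proof -
  define A where "A = {x \<in> U - {v, w}. linked E (U - {v, w}) a x}"
  define B where "B = U - {v, w} - A"
  have aA: "a \<in> A" and bB: "b \<in> B" using ab by (auto simp: A_def B_def)
  have no: "\<not> E x y" if "x \<in> A" "y \<in> B" for x y
  proof
    assume "E x y"
    then have "linked E (U - {v, w}) x y"
      using that by (intro linked_edge) (auto simp: A_def B_def)
    then show False using that linked_trans by (fastforce simp: A_def B_def)
  qed
  have U: "U = A \<union> B \<union> {v, w}" "U = B \<union> A \<union> {v, w}" using vw by (auto simp: A_def B_def)
  have nvw: "v \<notin> A \<union> B" "w \<notin> A \<union> B" "A \<inter> B = {}" by (auto simp: A_def B_def)
  have "P \<subseteq> A \<union> {v, w} \<or> P \<subseteq> B \<union> {v, w}"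
  proof (rule ccontr)
    assume "\<not> ?thesis"
    then obtain x y where xy: "x \<in> P" "x \<notin> A \<union> {v, w}" "y \<in> P" "y \<notin> B \<union> {v, w}" by blast
    moreover have "P \<subseteq> U" using inst by (auto simp: thomassen_instance_def)
    ultimately have "x \<in> B" "y \<in> A" using U by blast+
    moreover from this have "E y x"
      using inst xy nvw by (auto simp: thomassen_instance_def)
    ultimately show False using no by blast
  qed
  have no': "\<not> E x y" if "x \<in> B" "y \<in> A" for x y
    using no that sym by blast
  show ?thesis
    using \<open>P \<subseteq> A \<union> {v, w} \<or> P \<subseteq> B \<union> {v, w}\<close>
  proof (elim disjE)
    assume "P \<subseteq> A \<union> {v, w}"
    then show ?thesis
      using aA bB nvw no vw by (intro glue_along_chord[OF inst IH _ _ vw(3) U(1)]) auto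
  next
    assume "P \<subseteq> B \<union> {v, w}"
    then show ?thesis
      using aA bB nvw no' vw by (intro glue_along_chord[OF inst IH _ _ vw(3) U(2)]) auto
  qed
qed

text \<open>With a third boundary neighbor \<open>w'\<close>, any two of \<open>p\<close>,
  \<open>w\<close>, \<open>w'\<close> would be linked after removing \<open>v\<close> and the
  remaining one, because no boundary edge separates \<open>U\<close>. That is the configuration
  excluded by \<open>no_apex_minor\<close>.\<close>

lemma boundary_degree:
  fixes L :: "'a \<Rightarrow> 'c set"
  assumes inst: "thomassen_instance Z U L P c"
    and nosplit: "\<And>v w a b. v \<in> U \<inter> attached E Z \<Longrightarrow> w \<in> U \<inter> attached E Z \<Longrightarrow> E v w \<Longrightarrow>
        a \<in> U - {v, w} \<Longrightarrow> b \<in> U - {v, w} \<Longrightarrow> linked E (U - {v, w}) a b"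
    and v: "v \<in> U \<inter> attached E Z" "E v p" "p \<in> U \<inter> attached E Z"
  shows "\<exists>w. {u \<in> U \<inter> attached E Z. E v u} \<subseteq> {p, w}"
proof (rule ccontr)
  assume *: "\<not> ?thesis"
  then obtain w where w: "w \<in> U \<inter> attached E Z" "E v w" "w \<noteq> p" by blast
  with * obtain w' where w': "w' \<in> U \<inter> attached E Z" "E v w'" "w' \<noteq> p" "w' \<noteq> w" by blast
  have ne: "v \<noteq> p" "v \<noteq> w" "v \<noteq> w'" using v w w' irrefl by auto
  show False
  proof (rule no_apex_minor[of Z U v p w w'])
    show "linked E (U - {v, w'}) p w" "linked E (U - {v, p}) w' w" "linked E (U - {v, w}) w' p"
      using v w w' ne by (auto intro!: nosplit)
  qed (use inst v w w' ne in \<open>simp_all add: thomassen_instance_def\<close>)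
qed

text \<open>Two colors of \<open>v\<close> other than that of \<open>p\<close> are reserved by removing them from the inner
  neighbors; one of them survives, since \<open>v\<close> has at most one further boundary neighbor.\<close>

lemma color_precolored_edge:
  fixes L :: "'a \<Rightarrow> 'c set"
  assumes inst: "thomassen_instance Z U L P c"
    and IH: "\<forall>Z' U' (L' :: 'a \<Rightarrow> 'c set) P' c'. card U' < card U \<longrightarrow>
        thomassen_instance Z' U' L' P' c' \<longrightarrow> list_colorable E U' L' P' c'"
    and nosplit: "\<And>v w a b. v \<in> U \<inter> attached E Z \<Longrightarrow> w \<in> U \<inter> attached E Z \<Longrightarrow> E v w \<Longrightarrow>
        a \<in> U - {v, w} \<Longrightarrow> b \<in> U - {v, w} \<Longrightarrow> linked E (U - {v, w}) a b"
    and p: "p \<in> P" and v: "v \<in> U \<inter> attached E Z" "v \<notin> P" "E p v"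
  shows "list_colorable E U L P c"
proof -
  have fin: "finite U" and PU: "P \<subseteq> U \<inter> attached E Z"
    using inst by (auto simp: thomassen_instance_def)
  obtain w where w: "{u \<in> U \<inter> attached E Z. E v u} \<subseteq> {p, w}"
    using boundary_degree[OF inst nosplit v(1) sym[OF v(3)]] p PU by blast
  have "card (L v) \<ge> 3"
    using thomassen_instance_list[OF inst, of v] v by auto
  moreover have "card (L v - {c p}) \<ge> card (L v) - card {c p}" by (rule diff_card_le_card_Diff) simp
  ultimately have "card (L v - {c p}) \<ge> 2" by simp
  then obtain S where "S \<subseteq> L v - {c p}" "card S = 2" by (rule obtain_subset_with_card_n)
  then obtain \<alpha> \<beta> where ab: "\<alpha> \<in> L v - {c p}" "\<beta> \<in> L v - {c p}" "\<alpha> \<noteq> \<beta>" by (auto simp: card_2_iff)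
  define L' where "L' u = (if E v u \<and> u \<notin> attached E Z then L u - {\<alpha>, \<beta>} else L u)" for u
  \<comment> \<open>Inner neighbors of \<open>v\<close> join the new boundary; they lose at most two
    of five colors and so keep the three required there. Vertices already attached to
    \<open>Z\<close> lose none.\<close>
  have "thomassen_instance (insert v Z) (U - {v}) L' P c"
    unfolding thomassen_instance_def
  proof (intro conjI)
    show "\<forall>x\<in>insert v Z. \<forall>y\<in>insert v Z. linked E (insert v Z) x y"
      using inst v by (intro linked_insert) (auto simp: thomassen_instance_def)
    show "\<forall>u\<in>U - {v} - P. card (L' u) \<ge> (if u \<in> attached E (insert v Z) then 3 else 5)"
    proof
      fix u assume u: "u \<in> U - {v} - P"
      then have *: "card (L u) \<ge> (if u \<in> attached E Z then 3 else 5)"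
        by (intro thomassen_instance_list[OF inst]) auto
      have "card (L u - {\<alpha>, \<beta>}) \<ge> card (L u) - card {\<alpha>, \<beta>}"
        by (rule diff_card_le_card_Diff) simp
      then have "card (L u - {\<alpha>, \<beta>}) \<ge> card (L u) - 2"
        using ab by simp
      with * show "card (L' u) \<ge> (if u \<in> attached E (insert v Z) then 3 else 5)"
        by (auto simp: L'_def attached_insert split: if_splits)
    qed
    show "P \<subseteq> (U - {v}) \<inter> attached E (insert v Z)"
      using PU v by (auto simp: attached_insert)
  qed (use inst v in \<open>auto simp: thomassen_instance_def\<close>)
  moreover have "card (U - {v}) < card U"
    using fin v by (intro psubset_card_mono) auto
  ultimately have "list_colorable E (U - {v}) L' P c"
    using IH by blast
  then obtain \<psi> where \<psi>:
    "\<forall>x\<in>U - {v}. \<forall>y\<in>U - {v}. E x y \<longrightarrow> \<psi> x \<noteq> \<psi> y" "\<forall>u\<in>P. \<psi> u = c u" "\<forall>u\<in>U - {v} - P. \<psi> u \<in> L' u"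
    unfolding list_colorable_def by blast
  define \<gamma> where "\<gamma> = (if \<psi> w = \<alpha> then \<beta> else \<alpha>)"
  have \<gamma>: "\<gamma> \<noteq> \<psi> w" "\<gamma> \<in> L v" "\<gamma> \<noteq> c p" "\<gamma> \<in> {\<alpha>, \<beta>}" using ab by (auto simp: \<gamma>_def)
  have nbr: "\<psi> u \<noteq> \<gamma>" if "u \<in> U" "E v u" for u
  proof (cases "u \<in> attached E Z")
    case True
    then have "u = p \<or> u = w" using w that by blast
    then show ?thesis using \<gamma> \<psi>(2) p by auto
  next
    case False
    then have "u \<in> U - {v} - P" using that irrefl PU by auto
    then have "\<psi> u \<in> L' u" using \<psi>(3) by blast
    then show ?thesis using False that \<gamma>(4) by (auto simp: L'_def)
  qed
  let ?f = "\<psi>(v := \<gamma>)"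
  have "?f x \<noteq> ?f y" if "x \<in> U" "y \<in> U" "E x y" for x y
    using that nbr[of x] nbr[of y] \<psi>(1) sym irrefl by (cases "x = v"; cases "y = v") fastforce+
  moreover have "?f u = c u" if "u \<in> P" for u
    using \<psi>(2) that v by auto
  moreover have "?f u \<in> L u" if "u \<in> U - P" for u
    using \<psi>(3) that \<gamma>(2) by (fastforce simp: L'_def split: if_splits)
  ultimately show ?thesis unfolding list_colorable_def by (intro exI[of _ ?f]) blast
qed

text \<open>Here \<open>p\<close> can be deleted with its own color: its neighbors outside
  \<open>P\<close> are all inner, so each enters the boundary with at least four colors, and another
  vertex of \<open>P\<close> has a different color already.\<close>

lemma color_isolated_precolored:
  fixes L :: "'a \<Rightarrow> 'c set"
  assumes inst: "thomassen_instance Z U L P c"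
    and IH: "\<forall>Z' U' (L' :: 'a \<Rightarrow> 'c set) P' c'. card U' < card U \<longrightarrow>
        thomassen_instance Z' U' L' P' c' \<longrightarrow> list_colorable E U' L' P' c'"
    and p: "p \<in> P" and iso: "\<And>v. v \<in> U \<inter> attached E Z \<Longrightarrow> E p v \<Longrightarrow> v \<in> P"
  shows "list_colorable E U L P c"
proof -
  have fin: "finite U" and PU: "P \<subseteq> U \<inter> attached E Z"
    using inst by (auto simp: thomassen_instance_def)
  define L' where "L' u = (if E p u then L u - {c p} else L u)" for u
  have "thomassen_instance (insert p Z) (U - {p}) L' (P - {p}) c"
    unfolding thomassen_instance_def
  proof (intro conjI)
    show "\<forall>x\<in>insert p Z. \<forall>y\<in>insert p Z. linked E (insert p Z) x y"
      using inst p PU by (intro linked_insert) (auto simp: thomassen_instance_def)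
    show "\<forall>u\<in>U - {p} - (P - {p}). card (L' u) \<ge> (if u \<in> attached E (insert p Z) then 3 else 5)"
    proof
      fix u assume u: "u \<in> U - {p} - (P - {p})"
      then have *: "card (L u) \<ge> (if u \<in> attached E Z then 3 else 5)"
        by (intro thomassen_instance_list[OF inst]) auto
      have "\<not> (E p u \<and> u \<in> attached E Z)" using iso u by blast
      moreover have "card (L u - {c p}) \<ge> card (L u) - card {c p}"
        by (rule diff_card_le_card_Diff) simp
      ultimately show "card (L' u) \<ge> (if u \<in> attached E (insert p Z) then 3 else 5)"
        using * by (auto simp: L'_def attached_insert split: if_splits)
    qed
    show "P - {p} \<subseteq> (U - {p}) \<inter> attached E (insert p Z)"
      using PU by (auto simp: attached_insert)
    show "card (P - {p}) \<le> 2"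
      using inst card_Diff1_le[of P p] by (auto simp: thomassen_instance_def)
  qed (use inst p PU in \<open>auto simp: thomassen_instance_def\<close>)
  moreover have "card (U - {p}) < card U"
    using fin p PU by (intro psubset_card_mono) auto
  ultimately have "list_colorable E (U - {p}) L' (P - {p}) c"
    using IH by blast
  then obtain \<psi> where \<psi>:
    "\<forall>x\<in>U - {p}. \<forall>y\<in>U - {p}. E x y \<longrightarrow> \<psi> x \<noteq> \<psi> y" "\<forall>u\<in>P - {p}. \<psi> u = c u"
    "\<forall>u\<in>U - {p} - (P - {p}). \<psi> u \<in> L' u"
    unfolding list_colorable_def by blast
  have nbr: "\<psi> u \<noteq> c p" if "u \<in> U" "E p u" for u
  proof (cases "u \<in> P")
    case True
    moreover have "u \<noteq> p" using that irrefl by auto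
    ultimately have "\<psi> u = c u" "c u \<noteq> c p"
      using \<psi>(2) inst p unfolding thomassen_instance_def by blast+
    then show ?thesis by simp
  next
    case False
    then have "\<psi> u \<in> L' u" using \<psi>(3) that p by auto
    then show ?thesis using that by (auto simp: L'_def)
  qed
  let ?f = "\<psi>(p := c p)"
  have "?f x \<noteq> ?f y" if "x \<in> U" "y \<in> U" "E x y" for x y
    using that nbr[of x] nbr[of y] \<psi>(1) sym irrefl by (cases "x = p"; cases "y = p") fastforce+
  moreover have "?f u = c u" if "u \<in> P" for u
    using \<psi>(2) that by auto
  moreover have "?f u \<in> L u" if "u \<in> U - P" for u
    using \<psi>(3) that p by (fastforce simp: L'_def split: if_splits)
  ultimately show ?thesis unfolding list_colorable_def by (intro exI[of _ ?f]) blast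
qed

lemma list_colorable_weaken:
  assumes "list_colorable E U L (insert p P) (c(p := \<gamma>))" "\<gamma> \<in> L p" "p \<notin> P"
  shows "list_colorable E U L P c"
proof -
  obtain \<psi> where \<psi>: "\<forall>x\<in>U. \<forall>y\<in>U. E x y \<longrightarrow> \<psi> x \<noteq> \<psi> y" "\<forall>u\<in>insert p P. \<psi> u = (c(p := \<gamma>)) u"
    "\<forall>u\<in>U - insert p P. \<psi> u \<in> L u"
    using assms(1) unfolding list_colorable_def by blast
  have "\<psi> u = c u" if "u \<in> P" for u using \<psi>(2) that assms(3) by auto
  moreover have "\<psi> u \<in> L u" if "u \<in> U - P" for u using \<psi>(2,3) that assms(2) by (cases "u = p") auto
  ultimately show ?thesis
    using \<psi>(1) unfolding list_colorable_def by blast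
qed

text \<open>Three reductions in turn: glue along a separating boundary edge; else delete a boundary
  vertex next to a precolored one; else delete a precolored vertex itself. If nothing is precolored,
  a vertex is chosen first.\<close>

theorem thomassen:
  fixes L :: "'a \<Rightarrow> 'c set"
  shows "thomassen_instance Z U L P c \<Longrightarrow> list_colorable E U L P c"
proof (induction "card U" arbitrary: Z U L P c rule: less_induct)
  case less
  have IH: "\<forall>Z' U' (L' :: 'a \<Rightarrow> 'c set) P' c'. card U' < card U \<longrightarrow>
        thomassen_instance Z' U' L' P' c' \<longrightarrow> list_colorable E U' L' P' c'"
    using less.hyps by blast
  note inst = less.prems
  have fin: "finite U" and PU: "P \<subseteq> U \<inter> attached E Z"
    using inst by (auto simp: thomassen_instance_def)
  have lst: "card (L u) \<ge> 3" if "u \<in> U - P" for u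
    using thomassen_instance_list[OF inst that] by (auto split: if_splits)
  show ?case
  proof (cases "\<exists>v w a b. v \<in> U \<inter> attached E Z \<and> w \<in> U \<inter> attached E Z \<and> E v w \<and>
        a \<in> U - {v, w} \<and> b \<in> U - {v, w} \<and> \<not> linked E (U - {v, w}) a b")
    case True
    then show ?thesis using color_by_chord[OF inst IH] by blast
  next
    case False
    then have nosplit: "linked E (U - {v, w}) a b"
      if "v \<in> U \<inter> attached E Z" "w \<in> U \<inter> attached E Z" "E v w" "a \<in> U - {v, w}" "b \<in> U - {v, w}"
      for v w a b using that by blast
    have pre: "list_colorable E U L P' c'"
      if "thomassen_instance Z U L P' c'" "P' \<noteq> {}" for P' c'
      using color_precolored_edge[OF that(1) IH nosplit] color_isolated_precolored[OF that(1) IH] that(2)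
      by blast
    show ?thesis
    proof (cases "P = {}")
      case False
      then show ?thesis using pre[OF inst] by simp
    next
      case P: True
      show ?thesis
      proof (cases "U \<inter> attached E Z = {}")
        case False
        then obtain p where p: "p \<in> U \<inter> attached E Z" by blast
        then have "L p \<noteq> {}" using lst[of p] P by auto
        then obtain \<gamma> where "\<gamma> \<in> L p" by blast
        \<comment> \<open>The vertex set does not shrink here: \<open>pre\<close> holds for the same
          \<open>U\<close> and any nonempty precolored set that forms an instance.\<close>
        moreover have "list_colorable E U L (insert p P) (c(p := \<gamma>))"
        proof (rule pre)
          show "thomassen_instance Z U L (insert p P) (c(p := \<gamma>))"
            using inst p unfolding thomassen_instance_def P by auto
        qed simp
        ultimately show ?thesis
          by (intro list_colorable_weaken[of U L p P c \<gamma>]) (simp_all add: P)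
      next
        case S: True
        show ?thesis
        proof (cases "U = {}")
          case True
          then show ?thesis using P by (auto simp: list_colorable_def)
        next
          case False
          then obtain p where p: "p \<in> U" by blast
          then have "L p \<noteq> {}" using lst[of p] P by auto
          then obtain \<gamma> where \<gamma>: "\<gamma> \<in> L p" by blast
          define L' where "L' u = (if E p u then L u - {\<gamma>} else L u)" for u
          \<comment> \<open>Nothing in \<open>U\<close> is attached to \<open>Z\<close>, so all
            lists have five colors and \<open>Z\<close> may be forgotten. The colored vertex
            \<open>p\<close> replaces it, and the neighbors of \<open>p\<close> become the
            boundary.\<close>
          have "thomassen_instance {p} (U - {p}) L' {} c"
            unfolding thomassen_instance_def
          proof (intro conjI)
            show "\<forall>u\<in>U - {p} - {}. card (L' u) \<ge> (if u \<in> attached E {p} then 3 else 5)"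
            proof
              fix u assume u: "u \<in> U - {p} - {}"
              then have *: "card (L u) \<ge> 5"
                using thomassen_instance_list[OF inst, of u] S P by (cases "u \<in> attached E Z") auto
              moreover have "card (L u - {\<gamma>}) \<ge> card (L u) - card {\<gamma>}"
                by (rule diff_card_le_card_Diff) simp
              ultimately show "card (L' u) \<ge> (if u \<in> attached E {p} then 3 else 5)"
                by (auto simp: L'_def attached_def)
            qed
          qed (use inst p in \<open>auto simp: thomassen_instance_def\<close>)
          moreover have "card (U - {p}) < card U"
            using fin p by (intro psubset_card_mono) auto
          ultimately have "list_colorable E (U - {p}) L' {} c"
    using IH by blast
  then obtain \<psi> where \<psi>:
            "\<forall>x\<in>U - {p}. \<forall>y\<in>U - {p}. E x y \<longrightarrow> \<psi> x \<noteq> \<psi> y" "\<forall>u\<in>U - {p} - {}. \<psi> u \<in> L' u"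
            unfolding list_colorable_def by blast
          let ?f = "\<psi>(p := \<gamma>)"
          have nbr: "\<psi> u \<noteq> \<gamma>" if "u \<in> U" "E p u" for u
            using \<psi>(2) that irrefl by (auto simp: L'_def dest!: bspec[of _ _ u])
          have "?f x \<noteq> ?f y" if "x \<in> U" "y \<in> U" "E x y" for x y
            using that nbr[of x] nbr[of y] \<psi>(1) sym irrefl
            by (cases "x = p"; cases "y = p") fastforce+
          moreover have "?f u \<in> L u" if "u \<in> U - P" for u
            using \<psi>(2) that \<gamma> by (fastforce simp: L'_def split: if_splits)
          ultimately show ?thesis
            unfolding list_colorable_def P by (intro exI[of _ ?f]) blast
        qed
      qed
    qed
  qed
qed

end

section \<open>Plane graphs\<close>

locale plane =
  fixes G :: "complex graph" and D :: drawing
  assumes plane: "plane_graph G D"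
begin

section \<open>Edges and induced subgraphs as point sets\<close>

definition adj :: "complex \<Rightarrow> complex \<Rightarrow> bool" where
  "adj x y \<longleftrightarrow> {x, y} \<in> edges G"

abbreviation drawn :: "complex set \<Rightarrow> complex set" where
  "drawn X \<equiv> point_set (induced_subgraph G X) D"

lemma adj_sym: "adj x y \<Longrightarrow> adj y x"
  by (simp add: adj_def insert_commute)

lemma edgeE:
  assumes "e \<in> edges G"
  obtains a b where "e = {a, b}" "a \<noteq> b" "a \<in> verts G" "b \<in> verts G"
  using assms plane unfolding plane_graph_def simple_graph_def
  by (metis card_2_iff insert_subset)

lemma finite_verts: "finite (verts G)"
  using plane by (simp add: plane_graph_def simple_graph_def)

lemma finite_edges: "finite (edges G)"
proof -
  have "edges G \<subseteq> Pow (verts G)"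
    using plane by (auto simp: plane_graph_def simple_graph_def)
  then show ?thesis using finite_verts by (metis finite_Pow_iff finite_subset)
qed

lemma adjD: "adj x y \<Longrightarrow> x \<noteq> y" "adj x y \<Longrightarrow> x \<in> verts G" "adj x y \<Longrightarrow> y \<in> verts G"
  unfolding adj_def by (auto elim!: edgeE simp: doubleton_eq_iff)

lemma edge_arc:
  assumes "{a, b} \<in> edges G"
  obtains g where "arc g" "path_image g = D {a, b}" "pathstart g = a" "pathfinish g = b"
proof -
  obtain g where g: "arc g" "path_image g = D {a, b}" "{pathstart g, pathfinish g} = {a, b}"
    using assms plane by (auto simp: plane_graph_def)
  then consider "pathstart g = a" "pathfinish g = b" | "pathstart g = b" "pathfinish g = a"
    by (auto simp: doubleton_eq_iff)
  then show ?thesis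
  proof cases
    case 1
    then show ?thesis using g that by blast
  next
    case 2
    then show ?thesis using g by (intro that[of "reversepath g"]) (auto simp: arc_reversepath)
  qed
qed

lemma ends_in_edge: "e \<in> edges G \<Longrightarrow> e \<subseteq> D e"
  by (metis edgeE edge_arc insert_subset empty_subsetI pathstart_in_path_image pathfinish_in_path_image)

lemma compact_edge: "e \<in> edges G \<Longrightarrow> compact (D e)"
  by (metis edgeE edge_arc compact_arc_image)

lemma edge_Int: "e \<in> edges G \<Longrightarrow> f \<in> edges G \<Longrightarrow> e \<noteq> f \<Longrightarrow> D e \<inter> D f \<subseteq> e \<inter> f"
  using plane unfolding plane_graph_def edge_interior_def by blast

lemma vertex_in_edge: "e \<in> edges G \<Longrightarrow> x \<in> verts G \<Longrightarrow> x \<in> D e \<Longrightarrow> x \<in> e"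
  using plane unfolding plane_graph_def edge_interior_def by blast

lemma drawn_alt: "drawn X = (verts G \<inter> X) \<union> (\<Union>e\<in>{e \<in> edges G. e \<subseteq> X}. D e)"
  by (simp add: point_set_def induced_subgraph_def)

lemma vertex_in_drawn: "x \<in> verts G \<Longrightarrow> x \<in> drawn X \<longleftrightarrow> x \<in> X"
  unfolding drawn_alt using vertex_in_edge by auto

lemma edge_vertices: "e \<in> edges G \<Longrightarrow> e \<subseteq> verts G"
  by (auto elim: edgeE)

text \<open>A point that is not a vertex lies on at most one edge, whose ends must then belong to
  both sets. With this, the disjointness of arcs in the planar arguments becomes a computation with
  vertex sets.\<close>

lemma drawn_Int: "drawn X \<inter> drawn Y = drawn (X \<inter> Y)"
proof
  show "drawn X \<inter> drawn Y \<subseteq> drawn (X \<inter> Y)"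
  proof
    fix x assume x: "x \<in> drawn X \<inter> drawn Y"
    show "x \<in> drawn (X \<inter> Y)"
    proof (cases "x \<in> verts G")
      case True
      then show ?thesis using x vertex_in_drawn by auto
    next
      case False
      then obtain e f where ef: "e \<in> edges G" "e \<subseteq> X" "x \<in> D e" "f \<in> edges G" "f \<subseteq> Y" "x \<in> D f"
        using x by (auto simp: drawn_alt)
      then have "e = f" using edge_Int[of e f] edge_vertices False by blast
      then show ?thesis using ef by (auto simp: drawn_alt)
    qed
  qed
  show "drawn (X \<inter> Y) \<subseteq> drawn X \<inter> drawn Y"
    by (auto simp: drawn_alt)
qed

lemma edge_not_subset_singleton: "e \<in> edges G \<Longrightarrow> \<not> e \<subseteq> {x}"
  by (auto elim!: edgeE)

lemma drawn_Int_singleton: "X \<inter> Y \<subseteq> {x} \<Longrightarrow> drawn X \<inter> drawn Y \<subseteq> {x}"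
  unfolding drawn_Int using edge_not_subset_singleton[of _ x] by (fastforce simp: drawn_alt)

lemma drawn_Int_empty: "X \<inter> Y = {} \<Longrightarrow> drawn X \<inter> drawn Y = {}"
  \<comment> \<open>A set contained in two different singletons is empty; the points 0 and 1 are
    arbitrary.\<close>
  using drawn_Int_singleton[of X Y 0] drawn_Int_singleton[of X Y 1] by auto

lemma drawn_edge:
  assumes "adj a b"
  shows "drawn {a, b} = D {a, b}"
proof -
  have "e = {a, b}" if "e \<in> edges G" "e \<subseteq> {a, b}" for e
    using that by (auto elim!: edgeE)
  then have "{e \<in> edges G. e \<subseteq> {a, b}} = {{a, b}}" using assms by (auto simp: adj_def)
  moreover have "verts G \<inter> {a, b} \<subseteq> D {a, b}" using ends_in_edge assms by (auto simp: adj_def)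
  ultimately show ?thesis by (auto simp: drawn_alt)
qed

lemma drawn_arc:
  assumes "adj a b"
  obtains g where "arc g" "path_image g = drawn {a, b}" "pathstart g = a" "pathfinish g = b"
  using edge_arc assms drawn_edge by (metis adj_def)

lemma drawn_mono: "X \<subseteq> Y \<Longrightarrow> drawn X \<subseteq> drawn Y"
  by (auto simp: drawn_alt)

lemma compact_drawn: "compact (drawn X)"
  unfolding drawn_alt using finite_verts finite_edges compact_edge
  by (intro compact_Un[OF finite_imp_compact compact_UN]) auto

section \<open>From walks in the graph to arcs in the plane\<close>

lemma linked_path_component:
  assumes "linked adj X x y" "x \<in> X" "x \<in> verts G"
  shows "path_component (drawn X) x y"
  using assms(1) unfolding linked_def
proof (induction rule: rtranclp_induct)
  case base
  then show ?case using assms by (simp add: path_component_refl vertex_in_drawn)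
next
  case (step y z)
  then have "adj y z" "drawn {y, z} \<subseteq> drawn X" by (auto intro!: drawn_mono)
  then obtain g where "arc g" "path_image g \<subseteq> drawn X" "pathstart g = y" "pathfinish g = z"
    by (metis drawn_arc)
  then have "path_component (drawn X) y z"
    unfolding path_component_def using arc_imp_path by blast
  with step.IH show ?case by (rule path_component_trans)
qed

lemma linked_arc:
  assumes "linked adj X x y" "x \<in> X" "x \<in> verts G" "x \<noteq> y"
  obtains g where "arc g" "path_image g \<subseteq> drawn X" "pathstart g = x" "pathfinish g = y"
  using linked_path_component[OF assms(1-3)] assms(4) path_contains_arc
  unfolding path_component_def by (metis subset_trans)

lemma path_connected_drawn:
  assumes "\<And>x y. x \<in> X \<Longrightarrow> y \<in> X \<Longrightarrow> linked adj X x y" "X \<subseteq> verts G"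
  shows "path_connected (drawn X)"
proof -
  \<comment> \<open>A point on an edge slides along it to one end, so only vertices have to be
    linked.\<close>
  have *: "\<exists>y\<in>X. path_component (drawn X) x y" if x: "x \<in> drawn X" for x
  proof (cases "x \<in> verts G")
    case True
    then have "x \<in> X" using that by (simp add: vertex_in_drawn)
    moreover have "path_component (drawn X) x x" using that by (rule path_component_refl)
    ultimately show ?thesis by blast
  next
    case False
    then obtain e where e: "e \<in> edges G" "e \<subseteq> X" "x \<in> D e"
      using x by (auto simp: drawn_alt)
    then obtain a b where ab: "e = {a, b}" by (meson edgeE)
    then obtain g where g: "arc g" "path_image g = D e"
      using e edge_arc by metis
    have "path_connected (D e)"
      using g path_connected_path_image arc_imp_path by metis
    moreover have "a \<in> D e" using ends_in_edge e ab by auto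
    ultimately have "path_component (D e) x a"
      using e by (simp add: path_connected_component)
    moreover have "D e \<subseteq> drawn X" using e by (auto simp: drawn_alt)
    ultimately show ?thesis
      using ab e path_component_of_subset by blast
  qed
  show ?thesis
    unfolding path_connected_component
  proof (intro ballI)
    fix x y assume "x \<in> drawn X" "y \<in> drawn X"
    then obtain a b where "a \<in> X" "path_component (drawn X) x a" "b \<in> X" "path_component (drawn X) y b"
      using * by meson
    moreover from this have "path_component (drawn X) a b"
      using linked_path_component assms by blast
    ultimately show "path_component (drawn X) x y"
      by (meson path_component_sym path_component_trans)
  qed
qed


text \<open>Let \<open>J\<close> be a closed curve through \<open>v\<close>, \<open>w1\<close>, \<open>Z\<close>, \<open>w2\<close>. The path from \<open>w1\<close> to \<open>w2\<close>
  crosses both the chord from \<open>v\<close> to \<open>Z\<close> and the one from \<open>v\<close> via \<open>w3\<close> to \<open>Z\<close>, so these two lie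
  on the same side of \<open>J\<close>. There the paths from \<open>w3\<close> to \<open>w1\<close> and \<open>w2\<close> cross the first of them.\<close>

lemma no_apex_minor:
  assumes Z: "Z \<subseteq> verts G" and U: "U \<subseteq> verts G" and ZU: "Z \<inter> U = {}"
    and conZ: "\<And>x y. x \<in> Z \<Longrightarrow> y \<in> Z \<Longrightarrow> linked adj Z x y"
    and att: "{v, w1, w2, w3} \<subseteq> U \<inter> attached adj Z"
    and dist: "distinct [v, w1, w2, w3]"
    and vw: "adj v w1" "adj v w2" "adj v w3"
    and l12: "linked adj (U - {v, w3}) w1 w2"
    and l32: "linked adj (U - {v, w1}) w3 w2"
    and l31: "linked adj (U - {v, w2}) w3 w1"
  shows False
proof -
  obtain z0 z1 z2 z3 where z: "z0 \<in> Z" "z1 \<in> Z" "z2 \<in> Z" "z3 \<in> Z"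
      "adj v z0" "adj w1 z1" "adj w2 z2" "adj w3 z3"
    using att adj_sym by (auto simp: attached_def)
  have inU: "v \<in> U" "w1 \<in> U" "w2 \<in> U" "w3 \<in> U" using att by auto
  then have inV: "v \<in> verts G" "w1 \<in> verts G" "w2 \<in> verts G" "w3 \<in> verts G" using U by auto
  have notZ: "v \<notin> Z" "w1 \<notin> Z" "w2 \<notin> Z" "w3 \<notin> Z" using ZU inU by auto
  have nez: "v \<noteq> z" "w1 \<noteq> z" "w2 \<noteq> z" "w3 \<noteq> z" if "z \<in> Z" for z using notZ that by auto
  have ne: "v \<noteq> w1" "v \<noteq> w2" "v \<noteq> w3" "w1 \<noteq> w2" "w1 \<noteq> w3" "w2 \<noteq> w3"
    using dist by auto
  note facts = inU notZ nez[OF z(1)] nez[OF z(2)] nez[OF z(3)] nez[OF z(4)] ne ne[symmetric] z(1-4)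
  \<comment> \<open>\<open>?A\<close> names the edges at \<open>v\<close>, \<open>?B\<close> the
    edges from \<open>w1\<close>, \<open>w2\<close>, \<open>w3\<close> into \<open>Z\<close>;
    \<open>?M1\<close>, \<open>?M2\<close>, \<open>?M3\<close> carry the walks that avoid
    \<open>v\<close> and the vertex of that index.\<close>
  let ?A1 = "drawn {v, w1}" and ?A2 = "drawn {v, w2}" and ?A3 = "drawn {v, w3}" and ?A0 = "drawn {v, z0}"
  let ?B1 = "drawn {w1, z1}" and ?B2 = "drawn {w2, z2}" and ?B3 = "drawn {w3, z3}" and ?Z = "drawn Z"
  let ?M3 = "drawn (U - {v, w3})" and ?M1 = "drawn (U - {v, w1})" and ?M2 = "drawn (U - {v, w2})"
  have pcZ: "path_connected ?Z" using path_connected_drawn[OF conZ Z] .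
  have zin: "z \<in> ?Z" if "z \<in> Z" for z using that Z by (auto simp: vertex_in_drawn)
  have pc_edge: "path_connected (drawn {a, b})" if "adj a b" for a b
    using drawn_arc[OF that] by (metis arc_imp_path path_connected_path_image)
  have ends: "a \<in> drawn {a, b}" "b \<in> drawn {a, b}" if "adj a b" for a b
    using that adjD by (auto simp: vertex_in_drawn)
  have pcEZ: "path_connected (drawn {a, b} \<union> ?Z)" if "adj a b" "b \<in> Z" for a b
    using that by (intro path_connected_Un pc_edge pcZ) (use ends zin in blast)+
  obtain a1 where a1: "arc a1" "path_image a1 = ?A1" "pathstart a1 = v" "pathfinish a1 = w1"
    using drawn_arc[OF vw(1)] .
  obtain a2 where a2: "arc a2" "path_image a2 = ?A2" "pathstart a2 = v" "pathfinish a2 = w2"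
    using drawn_arc[OF vw(2)] .
  obtain a3 where a3: "arc a3" "path_image a3 = ?A3" "pathstart a3 = v" "pathfinish a3 = w3"
    using drawn_arc[OF vw(3)] .
  have "path_connected ((?B1 \<union> ?Z) \<union> (?B2 \<union> ?Z))"
    using z zin by (intro path_connected_Un pcEZ) auto
  moreover have "w1 \<in> (?B1 \<union> ?Z) \<union> (?B2 \<union> ?Z)" "w2 \<in> (?B1 \<union> ?Z) \<union> (?B2 \<union> ?Z)"
    using ends z by auto
  \<comment> \<open>\<open>T\<close> runs from \<open>w1\<close> through \<open>Z\<close> to
    \<open>w2\<close> and closes the edges from \<open>v\<close> to \<open>w1\<close> and
    \<open>w2\<close> to the curve \<open>J\<close>.\<close>
  ultimately obtain T where T: "arc T" "path_image T \<subseteq> (?B1 \<union> ?Z) \<union> (?B2 \<union> ?Z)"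
      "pathstart T = w1" "pathfinish T = w2"
    using ne(4) unfolding path_connected_arcwise by metis
  \<comment> \<open>Otherwise \<open>T\<close> would be covered by the closed sets
    \<open>?B1\<close> and \<open>?B2\<close>, which meet only in \<open>?Z\<close>. A point of
    \<open>T\<close> in \<open>?Z\<close> gives the arcs \<open>c\<close> and \<open>k\<close> below
    a target.\<close>
  have TZ: "path_image T \<inter> ?Z \<noteq> {}"
  proof
    assume "path_image T \<inter> ?Z = {}"
    moreover have "?B1 \<inter> ?B2 \<subseteq> ?Z"
      unfolding drawn_Int by (rule drawn_mono) (use facts in auto)
    moreover have "w1 \<in> path_image T" "w2 \<in> path_image T"
      using T(3,4) by (metis pathstart_in_path_image, metis pathfinish_in_path_image)
    moreover have "closed ?B1" "closed ?B2" using compact_drawn compact_imp_closed by auto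
    moreover have "w1 \<in> ?B1" "w2 \<in> ?B2" using ends z by auto
    ultimately show False
      using connected_closedD[of "path_image T" ?B1 ?B2] connected_arc_image[OF T(1)] T(2) by blast
  qed
  have clT: "closed (path_image T)"
    using T(1) closed_arc_image by blast
  have vT: "v \<notin> path_image T" and w3T: "w3 \<notin> path_image T"
    using T(2) inV facts by (auto simp: vertex_in_drawn)
  have TZ': "(drawn {a, b} \<union> ?Z) \<inter> path_image T \<noteq> {}" for a b using TZ by blast
  have "v \<in> ?A0 \<union> ?Z" using ends z by auto
  \<comment> \<open>\<open>c\<close> stops at its first point on \<open>T\<close>, so it meets
    \<open>T\<close> only in its end; \<open>k\<close> is the analogue from
    \<open>w3\<close>.\<close>
  then obtain c where c: "arc c" "path_image c \<subseteq> ?A0 \<union> ?Z" "pathstart c = v"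
      "path_image c \<inter> path_image T = {pathfinish c}"
    using arc_to_closed_set[OF pcEZ clT _ vT TZ'] z by metis
  have "w3 \<in> ?B3 \<union> ?Z" using ends z by auto
  then obtain k where k: "arc k" "path_image k \<subseteq> ?B3 \<union> ?Z" "pathstart k = w3"
      "path_image k \<inter> path_image T = {pathfinish k}"
    using arc_to_closed_set[OF pcEZ clT _ w3T TZ'] z by metis
  define t where "t = pathfinish c"
  \<comment> \<open>\<open>c\<close> and \<open>k\<close> stay in \<open>?Z\<close> and in the edges
    from \<open>v\<close> and \<open>w3\<close> into \<open>Z\<close>, hence miss \<open>w1\<close>
    and \<open>w2\<close>.\<close>
  have tT: "t \<in> path_image T" "t \<noteq> w1" "t \<noteq> w2"
    and kT: "pathfinish k \<in> path_image T" "pathfinish k \<noteq> w1" "pathfinish k \<noteq> w2"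
    using c(2,4) k(2,4) inV facts
    unfolding t_def by (auto simp: vertex_in_drawn set_eq_iff subset_iff)
  obtain b c' where bc: "arc b" "pathstart b = w1" "pathfinish b = t" "arc c'" "pathstart c' = t"
      "pathfinish c' = w2" "path_image b \<union> path_image c' = path_image T"
      "path_image b \<inter> path_image c' = {t}"
    using arc_split[OF T(1) tT(1)] tT T by metis
  obtain m where m: "arc m" "path_image m \<subseteq> ?M3" "pathstart m = w1" "pathfinish m = w2"
    using linked_arc[OF l12] inV facts by blast
  obtain n where n: "arc n" "path_image n \<subseteq> ?M1" "pathstart n = w3" "pathfinish n = w2"
    using linked_arc[OF l32] inV facts by blast
  obtain n' where n': "arc n'" "path_image n' \<subseteq> ?M2" "pathstart n' = w3" "pathfinish n' = w1"
    using linked_arc[OF l31] inV facts by blast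
  define J where "J = ?A1 \<union> ?A2 \<union> path_image T"
  have A12: "?A1 \<inter> ?A2 = {v}"
    using drawn_Int_singleton[of "{v, w1}" "{v, w2}" v] ends vw facts by auto
  have A1T: "?A1 \<inter> path_image T = {w1}" and A2T: "?A2 \<inter> path_image T = {w2}"
  proof -
    have "?A1 \<inter> ?B1 \<subseteq> {w1}" "?A1 \<inter> ?B2 = {}" "?A1 \<inter> ?Z = {}" "?A2 \<inter> ?B2 \<subseteq> {w2}" "?A2 \<inter> ?B1 = {}" "?A2 \<inter> ?Z = {}"
      using facts by (intro drawn_Int_singleton drawn_Int_empty; auto)+
    then have "?A1 \<inter> path_image T \<subseteq> {w1}" "?A2 \<inter> path_image T \<subseteq> {w2}" using T(2) by blast+
    moreover have "w1 \<in> path_image T" "w2 \<in> path_image T"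
      using T(3,4) by (metis pathstart_in_path_image, metis pathfinish_in_path_image)
    moreover have "w1 \<in> ?A1" "w2 \<in> ?A2" using ends vw by auto
    ultimately show "?A1 \<inter> path_image T = {w1}" "?A2 \<inter> path_image T = {w2}" by auto
  qed
  have mJ: "path_image m \<inter> J = {w1, w2}"
  proof -
    have "?M3 \<inter> ?A1 \<subseteq> {w1}" "?M3 \<inter> ?A2 \<subseteq> {w2}" "?M3 \<inter> ?B1 \<subseteq> {w1}" "?M3 \<inter> ?B2 \<subseteq> {w2}" "?M3 \<inter> ?Z = {}"
      using facts ZU by (intro drawn_Int_singleton drawn_Int_empty; auto)+
    then have "path_image m \<inter> J \<subseteq> {w1, w2}"
      using m(2) T(2) unfolding J_def by (simp add: subset_iff disjoint_iff) metis
    moreover have "w1 \<in> path_image m" "w2 \<in> path_image m"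
      using m(3,4) by (metis pathstart_in_path_image, metis pathfinish_in_path_image)
    moreover have "w1 \<in> J" "w2 \<in> J" using A1T A2T unfolding J_def by auto
    ultimately show ?thesis by auto
  qed
  have mc: "path_image m \<inter> path_image c = {}"
  proof -
    have "?M3 \<inter> ?A0 = {}" "?M3 \<inter> ?Z = {}"
      using facts ZU by (intro drawn_Int_empty; auto)+
    then show ?thesis using m(2) c(2) by blast
  qed
  have cJ: "path_image c \<inter> J = {v, t}" "v \<in> path_image c" "t \<in> path_image c"
  proof -
    have "?A0 \<inter> ?A1 \<subseteq> {v}" "?A0 \<inter> ?A2 \<subseteq> {v}" "?Z \<inter> ?A1 = {}" "?Z \<inter> ?A2 = {}"
      using facts by (intro drawn_Int_singleton drawn_Int_empty; auto)+
    then have "path_image c \<inter> J \<subseteq> {v, t}"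
      using c(2,4) unfolding J_def t_def by (simp add: subset_iff disjoint_iff set_eq_iff) metis
    moreover show "v \<in> path_image c" "t \<in> path_image c"
      using c(3) t_def by (metis pathstart_in_path_image, metis pathfinish_in_path_image)
    moreover have "v \<in> J" "t \<in> J" using A12 tT unfolding J_def by auto
    ultimately show "path_image c \<inter> J = {v, t}" by auto
  qed
  \<comment> \<open>The connection from \<open>v\<close> by way of \<open>w3\<close> to
    \<open>T\<close>, without its two ends.\<close>
  define \<delta>3 where "\<delta>3 = (?A3 - {v}) \<union> (path_image k - {pathfinish k})"
  have w3\<delta>: "w3 \<in> ?A3 - {v}" "w3 \<in> path_image k - {pathfinish k}"
    using ends vw facts k(1,3) arc_distinct_ends[OF k(1)] by auto
  have con3: "connected \<delta>3"
    unfolding \<delta>3_def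
    using connected_arc_minus_pathstart[OF a3(1)] connected_arc_minus_pathfinish[OF k(1)] a3 w3\<delta>
    by (intro connected_Un) auto
  have J3: "\<delta>3 \<inter> J = {}" and m3: "\<delta>3 \<inter> path_image m = {}"
  proof -
    have "?A3 \<inter> ?A1 \<subseteq> {v}" "?A3 \<inter> ?A2 \<subseteq> {v}" "?A3 \<inter> ?B1 = {}" "?A3 \<inter> ?B2 = {}" "?A3 \<inter> ?Z = {}"
      "?B3 \<inter> ?A1 = {}" "?B3 \<inter> ?A2 = {}" "?Z \<inter> ?A1 = {}" "?Z \<inter> ?A2 = {}"
      "?A3 \<inter> ?M3 = {}" "?B3 \<inter> ?M3 = {}" "?Z \<inter> ?M3 = {}"
      using facts ZU by (intro drawn_Int_singleton drawn_Int_empty; auto)+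
    then show "\<delta>3 \<inter> J = {}" "\<delta>3 \<inter> path_image m = {}"
      using k(2,4) T(2) m(2) unfolding J_def \<delta>3_def by (simp_all add: subset_iff disjoint_iff set_eq_iff) metis+
  qed
  have \<delta>3cl: "v \<in> closure \<delta>3" "pathfinish k \<in> closure \<delta>3"
  proof -
    have "v \<in> closure (?A3 - {v})"
      using pathfinish_in_closure_arc_interior[of "reversepath a3"] a3
        closure_mono[of "?A3 - {w3, v}" "?A3 - {v}"] by (auto simp: arc_reversepath)
    moreover have "pathfinish k \<in> closure (path_image k - {pathfinish k})"
      using pathfinish_in_closure_arc_interior[OF k(1)]
        closure_mono[of "path_image k - {pathstart k, pathfinish k}" "path_image k - {pathfinish k}"] by auto
    ultimately show "v \<in> closure \<delta>3" "pathfinish k \<in> closure \<delta>3"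
      unfolding \<delta>3_def by auto
  qed
  define \<delta>0 where "\<delta>0 = path_image c - {v, t}"
  have con0: "connected \<delta>0" and J0: "\<delta>0 \<inter> J = {}"
    using connected_simple_path_endless[OF arc_imp_simple_path[OF c(1)]] c(3) cJ
    by (auto simp: \<delta>0_def t_def)
  have \<delta>0cl: "v \<in> closure \<delta>0" "t \<in> closure \<delta>0"
    using pathfinish_in_closure_arc_interior[of c] pathfinish_in_closure_arc_interior[of "reversepath c"] c
    by (auto simp: \<delta>0_def t_def arc_reversepath insert_commute)
  define \<mu> where "\<mu> = path_image m - {w1, w2}"
  have con\<mu>: "connected \<mu>" and J\<mu>: "\<mu> \<inter> J = {}"
    using connected_simple_path_endless[OF arc_imp_simple_path[OF m(1)]] m(3,4) mJ
    by (auto simp: \<mu>_def)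
  have ne\<mu>: "\<mu> \<noteq> {}"
    using pathfinish_in_closure_arc_interior[OF m(1)] m(3,4) unfolding \<mu>_def by (metis closure_empty empty_iff)
  obtain R\<mu> where R\<mu>: "R\<mu> \<in> components (- J)" "\<mu> \<subseteq> R\<mu>"
    by (rule component_containing[of \<mu> "- J"]) (use con\<mu> J\<mu> ne\<mu> in auto)
  obtain R0 where R0: "R0 \<in> components (- J)" "\<delta>0 \<subseteq> R0"
    by (rule component_containing[of \<delta>0 "- J"]) (use con0 J0 \<delta>0cl in auto)
  obtain R3 where R3: "R3 \<in> components (- J)" "\<delta>3 \<subseteq> R3"
    by (rule component_containing[of \<delta>3 "- J"]) (use con3 J3 w3\<delta> \<delta>3_def in auto)
  \<comment> \<open>\<open>J\<close> is first viewed as two arcs between \<open>w1\<close> and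
    \<open>w2\<close>, one through \<open>v\<close> and one along \<open>T\<close>; the chord is
    then \<open>m\<close>.\<close>
  let ?via_v = "reversepath a1 +++ a2"
  have via_v: "arc ?via_v" "pathstart ?via_v = w1" "pathfinish ?via_v = w2" "path_image ?via_v = ?A1 \<union> ?A2"
    using a1 a2 A12 by (auto simp: arc_join_eq arc_reversepath path_image_join)
  have via_J: "path_image ?via_v \<union> path_image T = J" "path_image ?via_v \<inter> path_image T = {w1, w2}"
    using via_v A1T A2T by (auto simp: J_def)
  \<comment> \<open>No connected set off \<open>m\<close> with limit points at \<open>v\<close> and
    inside \<open>T\<close> lies on the side of \<open>m\<close>. Both \<open>\<delta>0\<close> and
    \<open>\<delta>3\<close> are such sets.\<close>
  have m_sep: False if "R \<in> components (- J)" "\<mu> \<subseteq> R" "connected \<delta>" "\<delta> \<subseteq> R" "\<delta> \<inter> path_image m = {}"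
      "v \<in> closure \<delta>" "x \<in> closure \<delta>" "x \<in> path_image T" "x \<noteq> w1" "x \<noteq> w2" for R \<delta> x
    by (rule no_crossing_chords[OF via_v(1-3) T(1,3,4) via_J(2), of R "path_image m" \<delta> v x])
      (use that m(1) mJ via_J(1) via_v facts A12 in \<open>auto simp: \<mu>_def compact_arc_image connected_arc_image\<close>)
  have "R\<mu> \<noteq> R0" using m_sep[of R0 \<delta>0 t] R0 R\<mu> con0 \<delta>0cl tT mc by (auto simp: \<delta>0_def)
  moreover have "R\<mu> \<noteq> R3" using m_sep[of R3 \<delta>3 "pathfinish k"] R3 R\<mu> con3 \<delta>3cl kT m3 by auto
  moreover obtain R R' where "components (- J) = {R, R'}"
    using theta_components[OF via_v(1-3) T(1,3,4) via_J(2)] via_J(1) by metis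
  ultimately have R30: "R3 = R0" using R\<mu>(1) R0(1) R3(1) by auto
  define \<delta> where "\<delta> = (path_image n - {w2}) \<union> (path_image n' - {w1})"
  have w3n: "w3 \<in> path_image n - {w2}" "w3 \<in> path_image n' - {w1}"
    using n(3) n'(3) facts by (metis DiffI pathstart_in_path_image singletonD)+
  have con\<delta>: "connected \<delta>"
    unfolding \<delta>_def
    using connected_arc_minus_pathfinish[OF n(1)] connected_arc_minus_pathfinish[OF n'(1)] n n' w3n
    by (intro connected_Un) auto
  have J\<delta>: "\<delta> \<inter> J = {}" and c\<delta>: "\<delta> \<inter> path_image c = {}"
  proof -
    have "?M1 \<inter> ?A1 = {}" "?M1 \<inter> ?A2 \<subseteq> {w2}" "?M1 \<inter> ?B1 = {}" "?M1 \<inter> ?B2 \<subseteq> {w2}" "?M1 \<inter> ?Z = {}" "?M1 \<inter> ?A0 = {}"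
      "?M2 \<inter> ?A2 = {}" "?M2 \<inter> ?A1 \<subseteq> {w1}" "?M2 \<inter> ?B2 = {}" "?M2 \<inter> ?B1 \<subseteq> {w1}" "?M2 \<inter> ?Z = {}" "?M2 \<inter> ?A0 = {}"
      using facts ZU by (intro drawn_Int_singleton drawn_Int_empty; auto)+
    then show "\<delta> \<inter> J = {}" "\<delta> \<inter> path_image c = {}"
      using n(2) n'(2) T(2) c(2) unfolding J_def \<delta>_def by (simp_all add: subset_iff disjoint_iff) metis+
  qed
  \<comment> \<open>\<open>w3\<close> is on both \<open>\<delta>\<close> and
    \<open>\<delta>3\<close>, and the latter lies in \<open>R3\<close>, which equals
    \<open>R0\<close>.\<close>
  have \<delta>R0: "\<delta> \<subseteq> R0"
    by (rule components_maximal[OF R0(1) con\<delta>]) (use J\<delta> R3(2) R30 w3\<delta> w3n in \<open>auto simp: \<delta>_def \<delta>3_def\<close>)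
  have \<delta>cl: "w1 \<in> closure \<delta>" "w2 \<in> closure \<delta>"
    using pathfinish_in_closure_arc_interior[OF n(1)] pathfinish_in_closure_arc_interior[OF n'(1)] n(3,4) n'(3,4)
      closure_mono[of "path_image n - {w3, w2}" \<delta>] closure_mono[of "path_image n' - {w3, w1}" \<delta>]
    by (auto simp: \<delta>_def)
  \<comment> \<open>\<open>J\<close> is now split at \<open>v\<close> and \<open>t\<close> instead,
    so that \<open>c\<close> is a chord and \<open>w1\<close> and \<open>w2\<close> lie inside
    different arcs.\<close>
  have s1: "arc (a1 +++ b)" "pathstart (a1 +++ b) = v" "pathfinish (a1 +++ b) = t" "path_image (a1 +++ b) = ?A1 \<union> path_image b"
    using a1 bc A1T by (auto simp: arc_join_eq path_image_join)
  have s2: "arc (a2 +++ reversepath c')" "pathstart (a2 +++ reversepath c') = v" "pathfinish (a2 +++ reversepath c') = t"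
      "path_image (a2 +++ reversepath c') = ?A2 \<union> path_image c'"
    using a2 bc A2T by (auto simp: arc_join_eq arc_reversepath path_image_join)
  have sJ: "path_image (a1 +++ b) \<union> path_image (a2 +++ reversepath c') = J"
    unfolding s1 s2 J_def using bc(7) by blast
  have s12: "path_image (a1 +++ b) \<inter> path_image (a2 +++ reversepath c') = {v, t}"
  proof -
    have "w1 \<notin> path_image c'" "w2 \<notin> path_image b"
      using bc tT by (metis IntI pathstart_in_path_image pathfinish_in_path_image singletonD)+
    then show ?thesis unfolding s1 s2 using A12 A1T A2T bc(7,8) by auto
  qed
  have "w1 \<in> path_image (a1 +++ b) - {v, t}" "w2 \<in> path_image (a2 +++ reversepath c') - {v, t}"
    unfolding s1 s2 using ends vw facts tT by auto
  then show False
    using R0 c(1) cJ(2,3) c\<delta> con\<delta> \<delta>R0 \<delta>cl unfolding sJ[symmetric]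
    by (intro no_crossing_chords[OF s1(1-3) s2(1-3) s12, of R0 "path_image c" \<delta> w1 w2])
      (auto simp: \<delta>0_def compact_arc_image connected_arc_image)
qed

sublocale apex_planar "verts G" adj
proof
  show "adj x y \<Longrightarrow> adj y x" "\<not> adj x x" for x y
    using adj_sym adjD(1) by blast+
qed (rule no_apex_minor)


section \<open>Cycles as closed curves\<close>

lemma index_path_arc:
  assumes "distinct xs" "\<And>i. Suc i < length xs \<Longrightarrow> adj (xs ! i) (xs ! Suc i)" "Suc k < length xs"
  shows "\<exists>g. arc g \<and> pathstart g = xs ! 0 \<and> pathfinish g = xs ! Suc k \<and>
    path_image g = (\<Union>i\<le>k. D {xs ! i, xs ! Suc i})"
  using assms(3)
proof (induction k)
  case 0
  then obtain g where "arc g" "path_image g = D {xs ! 0, xs ! 1}" "pathstart g = xs ! 0" "pathfinish g = xs ! 1"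
    using edge_arc assms(2)[of 0] by (auto simp: adj_def)
  then show ?case by auto
next
  case (Suc k)
  then obtain g where g: "arc g" "pathstart g = xs ! 0" "pathfinish g = xs ! Suc k"
      "path_image g = (\<Union>i\<le>k. D {xs ! i, xs ! Suc i})" by auto
  obtain h where h: "arc h" "path_image h = D {xs ! Suc k, xs ! Suc (Suc k)}"
      "pathstart h = xs ! Suc k" "pathfinish h = xs ! Suc (Suc k)"
    using edge_arc assms(2)[OF Suc.prems] by (auto simp: adj_def)
  have "D {xs ! i, xs ! Suc i} \<inter> path_image h \<subseteq> {xs ! Suc k}" if "i \<le> k" for i
  proof -
    \<comment> \<open>Distinctness of \<open>xs\<close> makes the new edge share at most the vertex
      \<open>xs ! Suc k\<close> with an earlier one, so the join is again an arc.\<close>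
    have *: "{xs ! i, xs ! Suc i} \<inter> {xs ! Suc k, xs ! Suc (Suc k)} \<subseteq> {xs ! Suc k}"
      "{xs ! i, xs ! Suc i} \<noteq> {xs ! Suc k, xs ! Suc (Suc k)}"
      using that Suc.prems assms(1) by (auto simp: nth_eq_iff_index_eq doubleton_eq_iff)
    have "D {xs ! i, xs ! Suc i} \<inter> path_image h \<subseteq> {xs ! i, xs ! Suc i} \<inter> {xs ! Suc k, xs ! Suc (Suc k)}"
      unfolding h(2) using assms(2)[of i] assms(2)[of "Suc k"] that Suc.prems
      by (intro edge_Int *(2)) (auto simp: adj_def)
    with * show ?thesis by blast
  qed
  then have "path_image g \<inter> path_image h \<subseteq> {xs ! Suc k}" unfolding g(4) by blast
  then have "arc (g +++ h)"
    using g h by (intro arc_join) auto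
  moreover have "path_image (g +++ h) = (\<Union>i\<le>Suc k. D {xs ! i, xs ! Suc i})"
    using g(3,4) h(2,3) by (simp add: path_image_join atMost_Suc Un_commute)
  ultimately show ?case using g h by (intro exI[of _ "g +++ h"]) auto
qed

text \<open>The cycle is an arc along \<open>xs\<close> followed by the edge from the last vertex
  back to the first.\<close>

lemma cycle_Jordan_curve:
  assumes C: "cycle_graph C" "edges C \<subseteq> edges G"
  obtains c where "simple_path c" "pathfinish c = pathstart c" "path_image c = point_set C D"
proof -
  obtain xs where xs: "distinct xs" "length xs \<ge> 3" "verts C = set xs"
      "edges C = {{xs ! i, xs ! (Suc i mod length xs)} | i. i < length xs}"
    using C(1) unfolding cycle_graph_def by blast
  define n where "n = length xs"
  have n3: "n \<ge> 3" using xs n_def by simp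
  have edge: "adj (xs ! i) (xs ! (Suc i mod n))" if "i < n" for i
    using that xs(4) C(2) unfolding adj_def n_def by blast
  have adjS: "adj (xs ! i) (xs ! Suc i)" if "Suc i < length xs" for i
    using edge[of i] that by (simp add: n_def)
  \<comment> \<open>The arc of \<open>index_path_arc\<close> ends at \<open>xs ! Suc k\<close>, so
    \<open>k = n - 2\<close> reaches the last vertex.\<close>
  have n2: "Suc (n - 2) = n - 1" "Suc (n - 2) < length xs" using n3 by (auto simp: n_def)
  obtain g where g: "arc g" "pathstart g = xs ! 0" "pathfinish g = xs ! (n - 1)"
      "path_image g = (\<Union>i\<le>n - 2. D {xs ! i, xs ! Suc i})"
    using index_path_arc[OF xs(1) adjS n2(2)] n2(1) by auto
  have last: "adj (xs ! (n - 1)) (xs ! 0)"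
    using edge[of "n - 1"] n3 by simp
  obtain h where h: "arc h" "path_image h = D {xs ! (n - 1), xs ! 0}"
      "pathstart h = xs ! (n - 1)" "pathfinish h = xs ! 0"
    using edge_arc last by (auto simp: adj_def)
  have "D {xs ! i, xs ! Suc i} \<inter> path_image h \<subseteq> {xs ! 0, xs ! (n - 1)}" if "i \<le> n - 2" for i
  proof -
    have "i < length xs" "0 < length xs" using that n3 unfolding n_def by linarith+
    then have "xs ! i = xs ! 0 \<longleftrightarrow> i = 0" by (rule nth_eq_iff_index_eq[OF xs(1)])
    \<comment> \<open>For \<open>i = 0\<close> the edge differs from the closing edge because
      \<open>n \<ge> 3\<close>.\<close>
    then have "{xs ! i, xs ! Suc i} \<noteq> {xs ! (n - 1), xs ! 0}"
      using that n3 xs(1) by (auto simp: nth_eq_iff_index_eq doubleton_eq_iff n_def)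
    then have "D {xs ! i, xs ! Suc i} \<inter> path_image h \<subseteq> {xs ! i, xs ! Suc i} \<inter> {xs ! (n - 1), xs ! 0}"
      unfolding h(2) using adjS[of i] last that n3
      by (intro edge_Int) (auto simp: adj_def n_def)
    then show ?thesis by blast
  qed
  then have "path_image g \<inter> path_image h \<subseteq> {xs ! 0, xs ! (n - 1)}" unfolding g(4) by blast
  then have "simple_path (g +++ h)"
    using g h by (intro simple_path_join_loop) auto
  moreover have "path_image (g +++ h) = point_set C D"
  proof -
    \<comment> \<open>Only the index \<open>n - 1\<close> wraps around under \<open>mod\<close>; it
      gives the closing edge.\<close>
    have "{..<n} = insert (n - 1) {..n - 2}" using n3 by auto
    moreover have "edges C = (\<lambda>i. {xs ! i, xs ! (Suc i mod n)}) ` {..<n}"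
      unfolding xs(4) n_def by auto
    ultimately have "edges C = insert {xs ! (n - 1), xs ! 0} ((\<lambda>i. {xs ! i, xs ! (Suc i mod n)}) ` {..n - 2})"
      using n3 by simp
    moreover have "(\<lambda>i. {xs ! i, xs ! (Suc i mod n)}) ` {..n - 2} = (\<lambda>i. {xs ! i, xs ! Suc i}) ` {..n - 2}"
      using n3 by (intro image_cong) auto
    ultimately have E: "edges C = insert {xs ! (n - 1), xs ! 0} ((\<lambda>i. {xs ! i, xs ! Suc i}) ` {..n - 2})"
      by simp
    have "verts C \<subseteq> (\<Union>e\<in>edges C. D e)"
    proof
      fix x assume "x \<in> verts C"
      then obtain i where "i < n" "x = xs ! i" using xs(3) by (auto simp: in_set_conv_nth n_def)
      then have "{x, xs ! (Suc i mod n)} \<in> edges C" unfolding xs(4) n_def by blast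
      then show "x \<in> (\<Union>e\<in>edges C. D e)" using ends_in_edge C(2) by blast
    qed
    then have "point_set C D = (\<Union>e\<in>edges C. D e)" by (auto simp: point_set_def)
    also have "\<dots> = path_image (g +++ h)"
      unfolding E using g h by (simp add: path_image_join Un_commute)
    finally show ?thesis by simp
  qed
  ultimately show ?thesis using that[of "g +++ h"] g h by simp
qed

lemma linked_cycle:
  assumes C: "cycle_graph C" "edges C \<subseteq> edges G" and "x \<in> verts C" "y \<in> verts C"
  shows "linked adj (verts C) x y"
proof -
  obtain xs where xs: "length xs \<ge> 3" "verts C = set xs"
      "edges C = {{xs ! i, xs ! (Suc i mod length xs)} | i. i < length xs}"
    using C(1) unfolding cycle_graph_def by blast
  have "linked adj (verts C) (xs ! 0) (xs ! i) \<and> linked adj (verts C) (xs ! i) (xs ! 0)"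
    if "i < length xs" for i
    using that
  proof (induction i)
    case (Suc i)
    then have "{xs ! i, xs ! (Suc i mod length xs)} \<in> edges C" unfolding xs(3) by auto
    then have "adj (xs ! i) (xs ! Suc i)"
      using C(2) Suc.prems unfolding adj_def by auto
    then have "linked adj (verts C) (xs ! i) (xs ! Suc i)" "linked adj (verts C) (xs ! Suc i) (xs ! i)"
      using Suc.prems xs(2) adj_sym by (auto intro!: linked_edge)
    then show ?case using Suc.IH Suc.prems linked_trans by (metis Suc_lessD)
  qed simp
  then show ?thesis
    using assms(3,4) xs(2) linked_trans by (metis in_set_conv_nth)
qed

text \<open>Off \<open>drawn K\<close>, a point of the star is \<open>a\<close> or lies on an edge
  from \<open>a\<close> to \<open>K\<close>, and that edge without its end in \<open>K\<close> is
  connected. This moves points of the star to its center within a face.\<close>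

lemma star_connected:
  assumes a: "a \<in> verts G" "a \<notin> K" and y: "y \<in> drawn ({a} \<union> K)" "y \<notin> drawn K"
  obtains S where "connected S" "a \<in> S" "y \<in> S" "S \<subseteq> drawn ({a} \<union> K)" "S \<inter> drawn K = {}"
proof (cases "y \<in> verts G")
  case True
  then have "y = a" using y by (auto simp: vertex_in_drawn)
  then show ?thesis using y by (intro that[of "{a}"]) auto
next
  case False
  then obtain e where e: "e \<in> edges G" "e \<subseteq> {a} \<union> K" "y \<in> D e"
    using y(1) by (auto simp: drawn_alt)
  with y(2) have "\<not> e \<subseteq> K" by (auto simp: drawn_alt)
  then obtain b where b: "e = {a, b}" "a \<noteq> b" "b \<in> K"
    using e(1,2) by (elim edgeE) (auto simp: insert_commute)
  then obtain g where g: "arc g" "path_image g = D e" "pathstart g = a" "pathfinish g = b"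
    using edge_arc e(1) by metis
  have "D e = drawn {a, b}" using drawn_edge e(1) b(1) by (simp add: adj_def)
  moreover have "drawn {a, b} \<inter> drawn K \<subseteq> {b}" using a(2) b by (intro drawn_Int_singleton) auto
  moreover have "drawn {a, b} \<subseteq> drawn ({a} \<union> K)" using b by (intro drawn_mono) auto
  moreover have "y \<noteq> b" using False e(1) b edge_vertices by auto
  moreover have "a \<in> D e" using ends_in_edge e(1) b by auto
  ultimately show ?thesis
    using connected_arc_minus_pathfinish[OF g(1)] g e(3) b by (intro that[of "D e - {b}"]) auto
qed

text \<open>An edge inside \<open>F\<close> has an end outside \<open>X\<close>. That end is in the
  closure of \<open>F\<close> but off \<open>drawn X\<close>, which contains the frontier of
  \<open>F\<close>, so it is in \<open>F\<close>. Hence faces can be compared by their vertices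
  alone.\<close>

lemma face_contains_vertex:
  assumes F: "F \<in> faces (induced_subgraph G X) D" "face_includes_some G D F"
  shows "F \<inter> verts G \<noteq> {}"
proof (cases "\<exists>x\<in>verts G. x \<in> F")
  case False
  then obtain e where e: "e \<in> edges G" "edge_interior D e \<subseteq> F"
    using F(2) by (auto simp: face_includes_some_def)
  have FX: "F \<in> components (- drawn X)" using F(1) by (simp add: faces_def)
  have cl: "u \<in> closure (edge_interior D e)" if u: "u \<in> e" for u
  proof -
    obtain b where b: "e = {b, u}"
      using e(1) u by (elim edgeE) auto
    then obtain g where "arc g" "path_image g = D e" "pathstart g = b" "pathfinish g = u"
      using edge_arc e(1) by metis
    then show ?thesis
      using pathfinish_in_closure_arc_interior[of g] b by (simp add: edge_interior_def)
  qed
  obtain a b where ab: "e = {a, b}" using e(1) by (elim edgeE)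
  have "edge_interior D e \<noteq> {}" using cl[of a] ab by auto
  then have "\<not> e \<subseteq> X"
    using e in_components_subset[OF FX] by (auto simp: drawn_alt edge_interior_def)
  then obtain u where u: "u \<in> e" "u \<notin> X" by blast
  then have "u \<in> closure F" using cl closure_mono[OF e(2)] by blast
  moreover have uV: "u \<in> verts G" using u e(1) edge_vertices by blast
  moreover have "frontier F \<subseteq> drawn X"
    using FX compact_drawn by (simp add: frontier_of_components_closed_complement compact_imp_closed)
  ultimately have "u \<in> F"
    using u(2) closure_Un_frontier[of F] by (auto simp: vertex_in_drawn)
  with uV show ?thesis by blast
qed auto

lemma neighbors_alt: "neighbors G u = {z. adj u z}"
  using adjD by (auto simp: neighbors_def adj_def)


section \<open>Critical canvases\<close>

text \<open>If every vertex of \<open>W\<close> had at most two neighbors on \<open>C\<close>, those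
  next to \<open>C\<close> would keep three of five colors, and \<open>thomassen\<close> with
  \<open>C\<close> as \<open>Z\<close> would extend every coloring of \<open>G\<close> minus
  \<open>W\<close> to \<open>G\<close>, against criticality. \<open>B\<close> is empty or the single
  vertex outside \<open>C\<close> through which \<open>W\<close> is attached to the rest of
  \<open>G\<close>.\<close>

lemma reducible_vertex_set:
  fixes L :: "complex \<Rightarrow> 'c set"
  assumes crit: "critical_canvas G D C L"
    and W: "W \<subseteq> verts G - verts C" "W \<noteq> {}"
    and B: "B \<subseteq> verts G - verts C" "W \<inter> B = {}" "card B \<le> 1" "B \<subseteq> attached adj (verts C)"
    and closed: "\<And>u y. u \<in> W \<Longrightarrow> adj u y \<Longrightarrow> y \<in> W \<union> B \<union> verts C"
  shows "\<exists>u\<in>W. card (neighbors G u \<inter> verts C) \<ge> 3"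
proof (rule ccontr)
  assume "\<not> ?thesis"
  then have few: "card (neighbors G u \<inter> verts C) \<le> 2" if "u \<in> W" for u
    using that by fastforce
  let ?K = "verts C" and ?G' = "induced_subgraph G (verts G - W)"
  have sC: "subgraph C G" and cyc: "cycle_graph C"
    using crit by (auto simp: critical_canvas_def canvas_def outer_cycle_def)
  then have CG: "simple_graph C" "verts C \<subseteq> verts G" "edges C \<subseteq> edges G" by (auto simp: subgraph_def)
  have sG: "simple_graph G" using plane by (simp add: plane_graph_def)
  have "subgraph ?G' G"
    using sG by (auto simp: subgraph_def simple_graph_def induced_subgraph_def)
  moreover have "?G' \<noteq> G"
  proof
    assume "?G' = G"
    then have "verts ?G' = verts G" by simp
    then show False using W by (auto simp: induced_subgraph_def)
  qed
  moreover have "subgraph C ?G'"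
  proof -
    have "?K \<subseteq> verts G - W" using CG W by blast
    moreover from this have "e \<subseteq> verts G - W" if "e \<in> edges C" for e
      using CG(1) that unfolding simple_graph_def by blast
    ultimately show ?thesis using CG by (auto simp: subgraph_def induced_subgraph_def)
  qed
  ultimately obtain \<phi> where \<phi>: "coloring_extends C ?G' L \<phi>" "\<not> coloring_extends C G L \<phi>"
    using crit unfolding critical_canvas_def proper_subgraph_def by metis
  then obtain \<psi> where \<psi>: "list_coloring ?G' L \<psi>" "\<forall>v\<in>?K. \<psi> v = \<phi> v"
    by (auto simp: coloring_extends_def)
  \<comment> \<open>Instances need finite lists, so exactly five colors are kept, also from an
    infinite list.\<close>
  have "\<exists>S. S \<subseteq> L u \<and> finite S \<and> card S = 5" if "u \<in> W" for u
  proof -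
    have "infinite (L u) \<or> card (L u) \<ge> 5"
      using crit that W by (auto simp: critical_canvas_def canvas_def)
    then show ?thesis
      by (metis infinite_arbitrarily_large obtain_subset_with_card_n card.infinite zero_neq_numeral)
  qed
  then obtain L5 where L5: "\<And>u. u \<in> W \<Longrightarrow> L5 u \<subseteq> L u \<and> finite (L5 u) \<and> card (L5 u) = 5" by metis
  define L' where "L' u = L5 u - \<psi> ` (neighbors G u \<inter> ?K)" for u
  have finK: "finite (neighbors G u \<inter> ?K)" for u
    using CG(2) finite_verts by (metis finite_Int finite_subset)
  have L'card: "card (L' u) \<ge> 5 - card (neighbors G u \<inter> ?K)" if "u \<in> W" for u
  proof -
    have "card (L5 u) - card (\<psi> ` (neighbors G u \<inter> ?K)) \<le> card (L' u)"
      unfolding L'_def using finK by (intro diff_card_le_card_Diff) auto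
    moreover have "card (\<psi> ` (neighbors G u \<inter> ?K)) \<le> card (neighbors G u \<inter> ?K)"
      using finK by (rule card_image_le)
    ultimately show ?thesis using L5[OF that] by linarith
  qed
  have finB: "finite B" using B(1) finite_verts by (metis finite_Diff finite_subset)
  have "thomassen_instance ?K (W \<union> B) L' B \<psi>"
    unfolding thomassen_instance_def
  proof (intro conjI)
    show "finite (W \<union> B)" using W(1) finB finite_verts by (metis finite_Diff finite_UnI finite_subset)
    show "\<forall>x\<in>?K. \<forall>y\<in>?K. linked adj ?K x y"
      using linked_cycle[OF cyc CG(3)] by blast
    \<comment> \<open>Vacuous, because \<open>B\<close> has at most one element.\<close>
    show "\<forall>p\<in>B. \<forall>q\<in>B. p \<noteq> q \<longrightarrow> adj p q \<and> \<psi> p \<noteq> \<psi> q"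
      using B(3) finB by (metis card_le_Suc0_iff_eq One_nat_def)
    show "\<forall>u\<in>W \<union> B - B. card (L' u) \<ge> (if u \<in> attached adj ?K then 3 else 5)"
    proof
      fix u assume "u \<in> W \<union> B - B"
      then have u: "u \<in> W" by blast
      show "card (L' u) \<ge> (if u \<in> attached adj ?K then 3 else 5)"
      proof (cases "u \<in> attached adj ?K")
        case True
        then show ?thesis using L'card[OF u] few[OF u] by simp
      next
        case False
        then have "neighbors G u \<inter> ?K = {}"
          using adj_sym by (auto simp: attached_def neighbors_alt)
        then show ?thesis using L'card[OF u] False by simp
      qed
    qed
  qed (use B W CG in auto)
  then have "list_colorable adj (W \<union> B) L' B \<psi>" by (rule thomassen)
  then obtain \<theta> where \<theta>: "\<forall>x\<in>W \<union> B. \<forall>y\<in>W \<union> B. adj x y \<longrightarrow> \<theta> x \<noteq> \<theta> y" "\<forall>u\<in>B. \<theta> u = \<psi> u"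
      "\<forall>u\<in>W \<union> B - B. \<theta> u \<in> L' u"
    unfolding list_colorable_def by blast
  have \<theta>L: "\<theta> u \<in> L' u" if "u \<in> W" for u using \<theta>(3) that B(2) by blast
  let ?f = "\<lambda>u. if u \<in> W then \<theta> u else \<psi> u"
  \<comment> \<open>Edges leaving \<open>W\<close> end in \<open>B\<close>, where the two colorings
    agree, or on \<open>C\<close>, whose colors were removed from the lists.\<close>
  have cross: "\<theta> x \<noteq> \<psi> y" if "x \<in> W" "y \<notin> W" "adj x y" for x y
  proof -
    have "y \<in> B \<or> y \<in> ?K" using closed[OF that(1,3)] that(2) by blast
    then show ?thesis
    proof
      assume "y \<in> B"
      then show ?thesis using \<theta>(1,2) that by (metis UnI1 UnI2)
    next
      assume "y \<in> ?K"
      then have "\<psi> y \<notin> L' x" using that by (auto simp: L'_def neighbors_alt)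
      then show ?thesis using \<theta>L[OF that(1)] by metis
    qed
  qed
  have "list_coloring G L ?f"
    unfolding list_coloring_def
  proof (intro conjI ballI allI impI)
    fix u assume "u \<in> verts G"
    then show "?f u \<in> L u"
      using \<psi>(1) \<theta>L[of u] L5[of u] by (auto simp: list_coloring_def induced_subgraph_def L'_def)
  next
    fix x y assume "{x, y} \<in> edges G"
    then have xy: "adj x y" by (simp add: adj_def)
    show "?f x \<noteq> ?f y"
    proof (cases "x \<in> W \<or> y \<in> W")
      case True
      then show ?thesis
        using \<theta>(1) cross[of x y] cross[of y x] xy adj_sym[OF xy] by auto
    next
      case False
      then have "{x, y} \<in> edges ?G'"
        using xy adjD[OF xy] by (auto simp: induced_subgraph_def adj_def)
      then show ?thesis using \<psi>(1) False by (auto simp: list_coloring_def)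
    qed
  qed
  moreover have "?f v = \<phi> v" if "v \<in> ?K" for v
    using that W \<psi>(2) by auto
  ultimately have "coloring_extends C G L \<phi>"
    unfolding coloring_extends_def by blast
  with \<phi>(2) show False ..
qed

text \<open>Off \<open>C\<close>, the star of \<open>x\<close> lies in \<open>F\<close>. If \<open>F'\<close> were disjoint from \<open>F\<close>, its frontier would
  therefore lie on \<open>C\<close> and \<open>F'\<close> would be one of the two sides of \<open>C\<close>. But one side is the outer
  face of \<open>G\<close>, which contains no vertex, and the other side contains \<open>x\<close>.\<close>

lemma face_inside_face:
  assumes out: "outer_cycle G D C" and drawnC: "drawn (verts C) = point_set C D"
    and v: "v \<in> verts G - verts C" and x: "x \<in> verts G - verts C"
    and F: "F \<in> components (- drawn ({v} \<union> verts C))" "x \<in> F"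
    and F': "F' \<in> components (- drawn ({x} \<union> verts C))" "v \<notin> F'" "F' \<inter> verts G \<noteq> {}"
  shows "F' \<subseteq> F"
proof -
  let ?K = "verts C"
  have conF: "connected F" "connected F'" using F(1) F'(1) in_components_connected by blast+
  have opF: "open F"
    using F(1) compact_drawn by (metis compact_imp_closed open_Compl open_components)
  have subF: "F \<inter> drawn ({v} \<union> ?K) = {}" "F' \<inter> drawn ({x} \<union> ?K) = {}"
    using in_components_subset[OF F(1)] in_components_subset[OF F'(1)] by blast+
  have vx: "v \<noteq> x" using F(2) subF(1) v by (auto simp: vertex_in_drawn)
  have mono: "drawn ?K \<subseteq> drawn ({a} \<union> ?K)" for a by (intro drawn_mono) auto
  have Int: "drawn ({v} \<union> ?K) \<inter> drawn ({x} \<union> ?K) = drawn ?K"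
  proof -
    have "({v} \<union> ?K) \<inter> ({x} \<union> ?K) = ?K" using vx by auto
    then show ?thesis by (simp add: drawn_Int)
  qed
  \<comment> \<open>If \<open>F'\<close> met the star of \<open>v\<close>, the star would connect
    that point to \<open>v\<close> inside \<open>F'\<close>. As \<open>F'\<close> misses this
    drawing, it lies in \<open>F\<close> as soon as it meets \<open>F\<close>.\<close>
  have F'v: "F' \<inter> drawn ({v} \<union> ?K) = {}"
  proof (rule ccontr)
    assume "F' \<inter> drawn ({v} \<union> ?K) \<noteq> {}"
    then obtain y where y: "y \<in> F'" "y \<in> drawn ({v} \<union> ?K)" by blast
    then have "y \<notin> drawn ?K" using subF mono by blast
    then obtain S where S: "connected S" "v \<in> S" "y \<in> S" "S \<subseteq> drawn ({v} \<union> ?K)" "S \<inter> drawn ?K = {}"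
      using star_connected[of v ?K y] v y(2) by blast
    then have "S \<subseteq> - drawn ({x} \<union> ?K)" using Int by blast
    then have "S \<subseteq> F'"
      by (rule components_maximal[OF F'(1) S(1)]) (use y S in auto)
    then show False using S(2) F'(2) by blast
  qed
  have "F' \<inter> F \<noteq> {}"
  proof
    assume disj: "F' \<inter> F = {}"
    have "frontier F' \<subseteq> drawn ?K"
    proof
      fix y assume y: "y \<in> frontier F'"
      have "frontier F' \<subseteq> drawn ({x} \<union> ?K)"
        using F'(1) compact_drawn by (simp add: frontier_of_components_closed_complement compact_imp_closed)
      then have yx: "y \<in> drawn ({x} \<union> ?K)" using y by blast
      show "y \<in> drawn ?K"
      proof (rule ccontr)
        assume "y \<notin> drawn ?K"
        then obtain S where S: "connected S" "x \<in> S" "y \<in> S" "S \<subseteq> drawn ({x} \<union> ?K)" "S \<inter> drawn ?K = {}"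
          using star_connected[of x ?K y] x yx by blast
        then have "S \<subseteq> - drawn ({v} \<union> ?K)" using Int by blast
        then have "S \<subseteq> F"
          by (rule components_maximal[OF F(1) S(1)]) (use F(2) S in auto)
        then have "y \<in> F" using S(3) by blast
        moreover have "y \<in> closure F'" using y by (simp add: frontier_def)
        ultimately show False
          using disj opF open_Int_closure_eq_empty[of F F'] by blast
      qed
    qed
    moreover have "F' \<inter> drawn ?K = {}" "F' \<noteq> {}" using subF(2) mono F'(3) by blast+
    ultimately have F'K: "F' \<in> components (- drawn ?K)"
      using component_if_frontier_subset conF(2) by blast
    obtain F0 where F0: "F0 \<in> faces G D" "frontier F0 = drawn ?K"
      using out drawnC by (auto simp: outer_cycle_def)
    then have F0': "connected F0" "F0 \<noteq> {}" "F0 \<inter> point_set G D = {}"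
      using in_components_connected in_components_nonempty in_components_subset
      unfolding faces_def by blast+
    have "drawn ?K \<subseteq> point_set G D" unfolding drawn_alt by (auto simp: point_set_def)
    then have F0K: "F0 \<in> components (- drawn ?K)"
      using F0 F0' by (intro component_if_frontier_subset) auto
    have "x \<in> - drawn ?K" using x by (simp add: vertex_in_drawn)
    then obtain Rx where Rx: "Rx \<in> components (- drawn ?K)" "x \<in> Rx"
      using component_containing[of "{x}" "- drawn ?K"] by auto
    have V0: "F0 \<inter> verts G = {}" using F0'(3) by (auto simp: point_set_def)
    obtain c where "simple_path c" "pathfinish c = pathstart c" "path_image c = drawn ?K"
      using cycle_Jordan_curve[of C] out drawnC by (auto simp: outer_cycle_def subgraph_def)
    then obtain I E where "components (- drawn ?K) = {I, E}"
      using Jordan_components by metis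
    moreover have "F' \<noteq> F0" using F'(3) V0 by blast
    moreover have "Rx \<noteq> F0" using Rx(2) x V0 by blast
    moreover have "Rx \<noteq> F'" using Rx(2) F(2) disj by blast
    ultimately show False using F'K F0K Rx(1) by auto
  qed
  then show ?thesis
    using F'v conF(2) by (intro components_maximal[OF F(1)]) auto
qed

end

section \<open>The minimal pair of a heavy vertex and a face\<close>

theorem theorem2p10:
  fixes G C :: "complex graph" and D :: drawing and L :: "complex \<Rightarrow> 'c set"
  assumes "critical_canvas G D C L"
  shows "(\<exists>e. chord G C e) \<or>
         (\<exists>v\<in>verts G - verts C. card (neighbors G v \<inter> verts C) \<ge> 3 \<and>
            (\<exists>\<^sub>\<le>\<^sub>1F. F \<in> faces (induced_subgraph G ({v} \<union> verts C)) D \<and> face_includes_some G D F))"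
proof (rule ccontr)
  assume contra: "\<not> ?thesis"
  interpret plane G D
    using assms by unfold_locales (simp add: critical_canvas_def canvas_def)
  let ?K = "verts C"
  let ?X = "{v \<in> verts G - ?K. card (neighbors G v \<inter> ?K) \<ge> 3}"
  have out: "outer_cycle G D C"
    using assms by (simp add: critical_canvas_def canvas_def)
  then have CG: "simple_graph C" "?K \<subseteq> verts G" "edges C \<subseteq> edges G"
    by (auto simp: outer_cycle_def subgraph_def)
  \<comment> \<open>Without chords, all edges with both ends on \<open>C\<close> belong to
    \<open>C\<close>.\<close>
  have edgesC: "{e \<in> edges G. e \<subseteq> ?K} = edges C"
    using contra CG by (auto simp: chord_def simple_graph_def)
  have drawnC: "drawn ?K = point_set C D"
    unfolding drawn_alt edgesC using CG(2) by (auto simp: point_set_def)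
  \<comment> \<open>Since (2) fails at \<open>v\<close>, two different faces include something;
    being disjoint, they do not both contain \<open>u\<close>.\<close>
  have two_faces: "\<exists>F\<in>components (- drawn ({v} \<union> ?K)). F \<inter> verts G \<noteq> {} \<and> u \<notin> F" if v: "v \<in> ?X" for v u
  proof -
    obtain F1 F2 where F: "F1 \<noteq> F2" "F1 \<in> components (- drawn ({v} \<union> ?K))" "face_includes_some G D F1"
        "F2 \<in> components (- drawn ({v} \<union> ?K))" "face_includes_some G D F2"
      using contra v unfolding Uniq_def faces_def by blast
    then have "F1 \<inter> verts G \<noteq> {}" "F2 \<inter> verts G \<noteq> {}"
      using face_contains_vertex by (auto simp: faces_def)
    moreover have "u \<notin> F1 \<or> u \<notin> F2"
      using components_nonoverlap[OF F(2,4)] F(1) by blast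
    ultimately show ?thesis using F by blast
  qed
  define M where "M = {(v, F). v \<in> ?X \<and> F \<in> components (- drawn ({v} \<union> ?K)) \<and> F \<inter> verts G \<noteq> {}}"
  show False
  proof (cases "?X = {}")
    case True
    have "verts G - ?K \<noteq> {}"
    proof
      assume "verts G - ?K = {}"
      then have "verts G = ?K" using CG by blast
      moreover from this have "edges G = edges C" using edgesC edge_vertices by blast
      ultimately have "G = C" by simp
      then show False using assms by (simp add: critical_canvas_def)
    qed
    \<comment> \<open>Without heavy vertices the whole interior is taken as \<open>W\<close>, with
      \<open>B\<close> empty.\<close>
    then have "\<exists>u\<in>verts G - ?K. card (neighbors G u \<inter> ?K) \<ge> 3"
      by (intro reducible_vertex_set[OF assms, of _ "{}"]) (use adjD in auto)
    with True show False by blast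
  next
    case False
    then obtain m where "m \<in> M" using two_faces by (fastforce simp: M_def)
    then obtain v F where vF: "(v, F) \<in> M"
        "\<And>v' F'. (v', F') \<in> M \<Longrightarrow> card (F \<inter> verts G) \<le> card (F' \<inter> verts G)"
      using ex_has_least_nat[of "\<lambda>m. m \<in> M" m "\<lambda>(v, F). card (F \<inter> verts G)"] by fastforce
    have v: "v \<in> ?X" and F: "F \<in> components (- drawn ({v} \<union> ?K))" "F \<inter> verts G \<noteq> {}"
      using vF(1) by (auto simp: M_def)
    have Fv: "F \<inter> drawn ({v} \<union> ?K) = {}" using in_components_subset[OF F(1)] by blast
    have FV: "F \<inter> verts G \<subseteq> verts G - ?K" "v \<notin> F"
      using Fv v by (auto simp: vertex_in_drawn disjoint_iff)
    \<comment> \<open>Here \<open>W\<close> consists of the vertices in \<open>F\<close>; only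
      \<open>v\<close> and \<open>C\<close> can connect them to the rest.\<close>
    have "\<exists>x\<in>F \<inter> verts G. card (neighbors G x \<inter> ?K) \<ge> 3"
    proof (rule reducible_vertex_set[OF assms FV(1) F(2), of "{v}"])
      show "{v} \<subseteq> attached adj ?K"
      proof -
        have "neighbors G v \<inter> ?K \<noteq> {}" using v by force
        then show ?thesis using adj_sym by (auto simp: attached_def neighbors_alt)
      qed
      \<comment> \<open>An edge from \<open>F\<close> with no end at \<open>v\<close> or on
        \<open>C\<close> is disjoint from the drawing that bounds \<open>F\<close>, so its other end
        is also in \<open>F\<close>.\<close>
      show "y \<in> F \<inter> verts G \<union> {v} \<union> ?K" if u: "u \<in> F \<inter> verts G" "adj u y" for u y
      proof (rule ccontr)
        assume y: "\<not> ?thesis"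
        have "{u, y} \<inter> ({v} \<union> ?K) = {}" using y u FV by auto
        then have "drawn {u, y} \<inter> drawn ({v} \<union> ?K) = {}" by (rule drawn_Int_empty)
        moreover have "connected (drawn {u, y})"
          using drawn_arc[OF u(2)] connected_arc_image by metis
        moreover have "u \<in> drawn {u, y}" "y \<in> drawn {u, y}"
          using adjD[OF u(2)] by (auto simp: vertex_in_drawn)
        ultimately have "y \<in> F"
          using components_maximal[OF F(1), of "drawn {u, y}"] u by blast
        then show False using y adjD[OF u(2)] by blast
      qed
    qed (use v FV in auto)
    then obtain x where x: "x \<in> F" "x \<in> ?X" using FV by blast
    obtain F' where F': "F' \<in> components (- drawn ({x} \<union> ?K))" "F' \<inter> verts G \<noteq> {}" "v \<notin> F'"
      using two_faces[OF x(2)] by blast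
    then have "F' \<subseteq> F"
      using v x by (intro face_inside_face[OF out drawnC _ _ F(1) x(1)]) auto
    \<comment> \<open>\<open>x\<close> lies in \<open>F\<close> but on the drawing that has
      \<open>F'\<close> as a face, so the inclusion of vertex sets is strict.\<close>
    moreover have "x \<notin> F'"
      using in_components_subset[OF F'(1)] x(2) by (auto simp: vertex_in_drawn)
    ultimately have "F' \<inter> verts G \<subset> F \<inter> verts G" using x by blast
    then have "card (F' \<inter> verts G) < card (F \<inter> verts G)"
      using finite_verts by (intro psubset_card_mono) auto
    moreover have "(x, F') \<in> M" using x F' by (auto simp: M_def)
    ultimately show False using vF(2)[of x F'] by simp
  qed
qed

end
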